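(* Let $G=\langle s_1,\dots,s_r\rangle$ be a free group or free semigroup (with identity) of rank $r$. Let $K$ be finite or countable and let $\mu$ be a Borel probability measure on $K^G$ that is invariant under the canonical action $T$ of $G$ on $K^G$. Let $\alpha$ be the canonical partition of $K^G$ and suppose $H(\alpha)<\infty$ (with respect to $\mu$). Then $f(T,\mu,\alpha)\le F(T,\mu,\alpha)$, with equality if and only if $(T,K^G,\mu,\alpha)$ is Markov.
   Context: $G=\langle s_1,\dots,s_r\rangle$ is either a free group or a free semigroup with identity $e$ on $s_1,\dots,s_r$. Put $S=\{s_1^{\pm1},\dots,s_r^{\pm1}\}$ in the group case and $S=\{s_1,\dots,s_r\}$ in the semigroup case; $B(e,n)$ is the ball of radius $n$ about $e$ for the word metric of $S$. $K$ carries the discrete topology and $K^G$, the set of functions $x:G\to K$, the product topology. The canonical action is $T_gx(f)=x(fg)$ ($f,g\in G$), and the canonical partition is $\alpha=\{A_k:k\in K\}$ with $A_k=\{x\in K^G:x(e)=k\}$. $H(\alpha)=-\sum_{A\in\alpha}\mu(A)\log\mu(A)$, $\alpha\vee\beta=\{A\cap B\}$, $\alpha^n=\bigvee_{g\in B(e,n)}T_g^{-1}\alpha$, and, with entropies computed with respect to $\mu$, $$F(T,\mu,\alpha)=(1-2r)H(\alpha)+\sum_{i=1}^rH(\alpha\vee T_{s_i}^{-1}\alpha),\qquad f(T,\mu,\alpha)=\inf_{n>0}F(T,\mu,\alpha^n).$$ The left-Cayley graph $\Gamma_L$ has vertex set $G$ and an edge from $g$ to $sg$ for every $g\in G$, $s\in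 S$; paths in $\Gamma_L$ ignore edge directions. $\mathrm{Past}(g_1;g_2)$ is the set of $f\in G$ such that every path in $\Gamma_L$ from $f$ to $g_1$ passes through $g_2$. $(T,K^G,\mu,\alpha)$ is Markov if for every $s\in S$, $g\in G$, $A\in\alpha$, $$\mu\Big(T_{sg}^{-1}A\,\Big|\bigvee_{f\in\mathrm{Past}(sg;g)}T_f^{-1}\alpha\Big)=\mu(T_{sg}^{-1}A\,|\,T_g^{-1}\alpha)\quad\mu\text{-a.e.},$$ where $\mu(\cdot|\mathcal F)$ is conditional expectation of the characteristic function and joins of partitions are identified with the $\sigma$-algebras they generate. *)

theory Defs
  imports "HOL-Probability.Probability" "HOL-Algebra.Group"
begin

text \<open>
  The generators are given by a function \<open>s\<close> of which only the values \<open>s 1, \<dots>, s r\<close> matter.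
  A letter \<open>(i, True)\<close> stands for \<open>s i\<close>, and \<open>(i, False)\<close> for its inverse.
\<close>

fun letter_value :: "('g, 'm) monoid_scheme \<Rightarrow> (nat \<Rightarrow> 'g) \<Rightarrow> nat \<times> bool \<Rightarrow> 'g" where
  "letter_value G s (i, b) = (if b then s i else inv\<^bsub>G\<^esub> (s i))"

definition word_product :: "('g, 'm) monoid_scheme \<Rightarrow> 'g list \<Rightarrow> 'g" where
  "word_product G ws = foldr (\<lambda>a b. a \<otimes>\<^bsub>G\<^esub> b) ws \<one>\<^bsub>G\<^esub>"

definition reduced_word :: "(nat \<times> bool) list \<Rightarrow> bool" where
  "reduced_word = successively (\<lambda>u v. \<not> (fst u = fst v \<and> snd u \<noteq> snd v))"

text \<open>
  Every element of a free group (free semigroup with identity) is the value of exactly one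
  reduced word (exactly one word) in the generators.
\<close>

definition free_group_on :: "('g, 'm) monoid_scheme \<Rightarrow> (nat \<Rightarrow> 'g) \<Rightarrow> nat \<Rightarrow> bool" where
  "free_group_on G s r \<longleftrightarrow>
     group G \<and> s ` {1..r} \<subseteq> carrier G \<and>
     bij_betw (\<lambda>w. word_product G (map (letter_value G s) w))
       {w. set w \<subseteq> {1..r} \<times> UNIV \<and> reduced_word w} (carrier G)"

definition free_monoid_on :: "('g, 'm) monoid_scheme \<Rightarrow> (nat \<Rightarrow> 'g) \<Rightarrow> nat \<Rightarrow> bool" where
  "free_monoid_on G s r \<longleftrightarrow>
     monoid G \<and> s ` {1..r} \<subseteq> carrier G \<and>
     bij_betw (\<lambda>w. word_product G (map s w)) (lists {1..r}) (carrier G)"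

definition word_length :: "('g, 'm) monoid_scheme \<Rightarrow> 'g set \<Rightarrow> 'g \<Rightarrow> nat" where
  "word_length G S g = (LEAST n. \<exists>ws \<in> lists S. length ws = n \<and> word_product G ws = g)"

definition word_ball :: "('g, 'm) monoid_scheme \<Rightarrow> 'g set \<Rightarrow> nat \<Rightarrow> 'g set" where
  "word_ball G S n = {g \<in> carrier G. word_length G S g \<le> n}"

text \<open>
  \<open>K\<^sup>G\<close> is rendered by the functions on \<open>carrier G\<close> with values in \<open>K\<close>
  (extensional outside \<open>carrier G\<close>).
\<close>

definition config_topology :: "('g, 'm) monoid_scheme \<Rightarrow> 'k set \<Rightarrow> ('g \<Rightarrow> 'k) topology" where
  "config_topology G K = product_topology (\<lambda>_. discrete_topology K) (carrier G)"

definition configs :: "('g, 'm) monoid_scheme \<Rightarrow> 'k set \<Rightarrow> ('g \<Rightarrow> 'k) set" where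
  "configs G K = carrier G \<rightarrow>\<^sub>E K"

definition borel_of_topology :: "'a topology \<Rightarrow> 'a measure" where
  "borel_of_topology X = sigma (topspace X) {U. openin X U}"

definition act :: "('g, 'm) monoid_scheme \<Rightarrow> 'g \<Rightarrow> ('g \<Rightarrow> 'k) \<Rightarrow> ('g \<Rightarrow> 'k)" where
  "act G g x = (\<lambda>f \<in> carrier G. x (f \<otimes>\<^bsub>G\<^esub> g))"

definition act_preimage ::
    "('g, 'm) monoid_scheme \<Rightarrow> 'k set \<Rightarrow> 'g \<Rightarrow> ('g \<Rightarrow> 'k) set \<Rightarrow> ('g \<Rightarrow> 'k) set" where
  "act_preimage G K g A = act G g -` A \<inter> configs G K"

definition action_invariant ::
    "('g, 'm) monoid_scheme \<Rightarrow> 'k set \<Rightarrow> ('g \<Rightarrow> 'k) measure \<Rightarrow> bool" where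
  "action_invariant G K \<mu> \<longleftrightarrow>
     (\<forall>g \<in> carrier G. \<forall>A \<in> sets \<mu>. emeasure \<mu> (act_preimage G K g A) = emeasure \<mu> A)"

definition canonical_partition ::
    "('g, 'm) monoid_scheme \<Rightarrow> 'k set \<Rightarrow> ('g \<Rightarrow> 'k) set set" where
  "canonical_partition G K = (\<lambda>k. {x \<in> configs G K. x \<one>\<^bsub>G\<^esub> = k}) ` K"

definition pullback_partition ::
    "('g, 'm) monoid_scheme \<Rightarrow> 'k set \<Rightarrow> 'g \<Rightarrow> ('g \<Rightarrow> 'k) set set \<Rightarrow> ('g \<Rightarrow> 'k) set set" where
  "pullback_partition G K g P = act_preimage G K g ` P"

definition partition_join :: "'a set set \<Rightarrow> 'a set set \<Rightarrow> 'a set set" where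
  "partition_join P Q = {A \<inter> B |A B. A \<in> P \<and> B \<in> Q}"

text \<open>The join of the family \<open>P\<close> over a nonempty index set \<open>I\<close>.\<close>

definition partition_Join :: "'i set \<Rightarrow> ('i \<Rightarrow> 'a set set) \<Rightarrow> 'a set set" where
  "partition_Join I P = {(\<Inter>i\<in>I. C i) |C. \<forall>i\<in>I. C i \<in> P i}"

definition ball_partition ::
    "('g, 'm) monoid_scheme \<Rightarrow> 'k set \<Rightarrow> 'g set \<Rightarrow> nat \<Rightarrow> ('g \<Rightarrow> 'k) set set \<Rightarrow> ('g \<Rightarrow> 'k) set set" where
  "ball_partition G K S n P = partition_Join (word_ball G S n) (\<lambda>g. pullback_partition G K g P)"

text \<open>
  The sum over the cells is an integral against counting measure, so the entropy may be infinite.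
  Empty cells in joins contribute nothing, since \<open>ln 0 = 0\<close>.
\<close>

definition partition_entropy :: "'a measure \<Rightarrow> 'a set set \<Rightarrow> ennreal" where
  "partition_entropy \<mu> P = (\<integral>\<^sup>+A. ennreal (- (measure \<mu> A * ln (measure \<mu> A))) \<partial>count_space P)"

text \<open>
  The value of \<open>F\<close> is meaningful only if the entropies in it are finite; this is the case for
  all partitions \<open>\<alpha>\<^sup>n\<close> as soon as \<open>\<mu>\<close> is invariant and \<open>H(\<alpha>) < \<infinity>\<close>.
\<close>

definition F_inv ::
    "('g, 'm) monoid_scheme \<Rightarrow> 'k set \<Rightarrow> (nat \<Rightarrow> 'g) \<Rightarrow> nat \<Rightarrow> ('g \<Rightarrow> 'k) measure \<Rightarrow>
      ('g \<Rightarrow> 'k) set set \<Rightarrow> real" where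
  "F_inv G K s r \<mu> P =
     (1 - 2 * real r) * enn2real (partition_entropy \<mu> P) +
     (\<Sum>i = 1..r. enn2real (partition_entropy \<mu> (partition_join P (pullback_partition G K (s i) P))))"

text \<open>The infimum is taken in \<open>ereal\<close> because it may be \<open>-\<infinity>\<close>.\<close>

definition f_inv ::
    "('g, 'm) monoid_scheme \<Rightarrow> 'k set \<Rightarrow> (nat \<Rightarrow> 'g) \<Rightarrow> nat \<Rightarrow> 'g set \<Rightarrow> ('g \<Rightarrow> 'k) measure \<Rightarrow>
      ('g \<Rightarrow> 'k) set set \<Rightarrow> ereal" where
  "f_inv G K s r S \<mu> P = (INF n \<in> {0<..}. ereal (F_inv G K s r \<mu> (ball_partition G K S n P)))"

definition left_cayley_edges :: "('g, 'm) monoid_scheme \<Rightarrow> 'g set \<Rightarrow> ('g \<times> 'g) set" where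
  "left_cayley_edges G S = {(g, t \<otimes>\<^bsub>G\<^esub> g) |g t. g \<in> carrier G \<and> t \<in> S}"

definition left_cayley_path :: "('g, 'm) monoid_scheme \<Rightarrow> 'g set \<Rightarrow> 'g list \<Rightarrow> bool" where
  "left_cayley_path G S p \<longleftrightarrow>
     p \<noteq> [] \<and> set p \<subseteq> carrier G \<and>
     successively (\<lambda>u v. (u, v) \<in> left_cayley_edges G S \<or> (v, u) \<in> left_cayley_edges G S) p"

definition Past :: "('g, 'm) monoid_scheme \<Rightarrow> 'g set \<Rightarrow> 'g \<Rightarrow> 'g \<Rightarrow> 'g set" where
  "Past G S g1 g2 =
     {f \<in> carrier G. \<forall>p. left_cayley_path G S p \<and> hd p = f \<and> last p = g1 \<longrightarrow> g2 \<in> set p}"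

text \<open>
  A possibly infinite join of partitions, as a \<open>\<sigma>\<close>-algebra: the one generated by all cells of
  all the partitions, as opposed to the one generated by the (possibly uncountably many)
  infinite intersections of cells. Only the underlying \<open>\<sigma>\<close>-algebra matters here.
\<close>

definition join_algebra ::
    "('g, 'm) monoid_scheme \<Rightarrow> 'k set \<Rightarrow> 'g set \<Rightarrow> ('g \<Rightarrow> 'k) set set \<Rightarrow> ('g \<Rightarrow> 'k) measure" where
  "join_algebra G K I P = sigma (configs G K) (\<Union>f\<in>I. pullback_partition G K f P)"

definition Markov ::
    "('g, 'm) monoid_scheme \<Rightarrow> 'k set \<Rightarrow> 'g set \<Rightarrow> ('g \<Rightarrow> 'k) measure \<Rightarrow> ('g \<Rightarrow> 'k) set set \<Rightarrow> bool" where
  "Markov G K S \<mu> P \<longleftrightarrow>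
     (\<forall>t \<in> S. \<forall>g \<in> carrier G. \<forall>A \<in> P.
        AE x in \<mu>.
          real_cond_exp \<mu> (join_algebra G K (Past G S (t \<otimes>\<^bsub>G\<^esub> g) g) P)
            (indicator (act_preimage G K (t \<otimes>\<^bsub>G\<^esub> g) A)) x =
          real_cond_exp \<mu> (join_algebra G K {g} P)
            (indicator (act_preimage G K (t \<otimes>\<^bsub>G\<^esub> g) A)) x)"

end

theory Submission
  imports Defs "HOL-Library.Sublist"
begin

text \<open>
  Write \<open>X\<^sub>g\<close> for the coordinate \<open>x \<mapsto> x g\<close> and \<open>h W\<close> for the Shannon entropy of the family
  \<open>(X\<^sub>g)\<close> with \<open>g \<in> W\<close>, where \<open>W\<close> is a finite subset of \<open>G\<close>. Each partition occurring in \<open>F\<close> and \<open>f\<close>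
  records the values of a configuration on a finite set of sites (\<open>observed_partition\<close>); with
  \<open>B n\<close> for the ball of radius \<open>n\<close>,
  \<open>F(\<alpha>\<^sup>n) = (1 - 2r) h(B n) + (\<Sum>i. h(B n \<union> (B n)s\<^sub>i))\<close>, and \<open>\<alpha>\<^sup>0 = \<alpha>\<close>. Only two properties of \<open>h\<close> matter:
  it is invariant under right translations (\<open>site_entropy_translate\<close>), since \<open>\<mu>\<close> is invariant, and
  it is submodular (\<open>site_entropy_submodular\<close>), since conditional mutual information is nonnegative.

  The left Cayley graph is a tree, on which right translations act. Adding to a set a site
  \<open>tg\<close> next to a site \<open>g\<close> of the set raises \<open>h\<close> by at most \<open>h {e, t} - h {e}\<close>. For a
  finite subtree \<open>W\<close> containing \<open>e\<close> this yields \<open>h W \<le> T W\<close>, where \<open>T W\<close> is \<open>h {e}\<close> plus one such term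
  for each edge of \<open>W\<close>; \<open>T W\<close> is what the entropy would be for a tree-indexed Markov chain with the
  same two-site marginals. The Markov property is exactly the statement that no entropy is lost
  in these steps, hence that \<open>h (B n) = T (B n)\<close> for all \<open>n\<close>.

  Let \<open>c = 2\<close> for a group and \<open>c = 1\<close> for a semigroup. Applying submodularity to \<open>B (n+1)\<close> and
  its translate by \<open>s\<^sub>i\<close>, whose intersection contains \<open>B n \<union> (B n)s\<^sub>i\<close> or \<open>(B n)s\<^sub>i\<close> respectively,
  gives (\<open>F_on_ball_submodular\<close>)
  \<open>F(\<alpha>\<^sup>n\<^sup>+\<^sup>1) + (c - 1) F(\<alpha>\<^sup>n) + (1 + c(r - 1)) h(B n) \<le> h(B (n+1))\<close>,
  while counting reduced words by their last letter gives (\<open>tree_value_recursion\<close>)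
  \<open>T(B (n+1)) = c F(\<alpha>) + (1 + c(r - 1)) T(B n)\<close>.
  At \<open>n = 0\<close> these two facts together with \<open>h \<le> T\<close> say that \<open>F(\<alpha>\<^sup>1) \<le> F(\<alpha>)\<close>, so \<open>f \<le> F\<close>. If
  \<open>f = F\<close>, then \<open>F(\<alpha>\<^sup>n) \<ge> F(\<alpha>)\<close> for all \<open>n\<close>, and induction on \<open>n\<close> gives \<open>h(B n) \<ge> T(B n)\<close>, which is
  the Markov property. Conversely, for a Markov measure all entropies in \<open>F(\<alpha>\<^sup>n)\<close> are given by \<open>T\<close>,
  and the same count of words gives \<open>F(\<alpha>\<^sup>n) = F(\<alpha>)\<close>.

  The Markov property speaks of conditional expectations given a possibly infinite past. They
  are controlled by cylinders over the finite subsets \<open>V\<close> of the past, and for each \<open>V\<close> the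
  required product formula is the equality case of submodularity
  (\<open>Markov_iff_site_entropy\<close>).
\<close>

section \<open>Entropy of discrete random variables\<close>

definition atom_prob :: "'a measure \<Rightarrow> ('a \<Rightarrow> 'b) \<Rightarrow> 'a \<Rightarrow> real" where
  "atom_prob M X x = measure M {y \<in> space M. X y = X x}"

text \<open>
  In this integral form, entropy inequalities are integrated pointwise inequalities;
  \<open>rv_entropy_eq_sum\<close> recovers the usual sum over values.
\<close>

definition rv_entropy :: "'a measure \<Rightarrow> ('a \<Rightarrow> 'b) \<Rightarrow> ennreal" where
  "rv_entropy M X = (\<integral>\<^sup>+x. ennreal (- ln (atom_prob M X x)) \<partial>M)"

definition discrete_rv :: "'a measure \<Rightarrow> ('a \<Rightarrow> 'b) \<Rightarrow> bool" where
  "discrete_rv M X \<longleftrightarrow> countable (X ` space M) \<and> (\<forall>v. {x \<in> space M. X x = v} \<in> sets M)"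

lemma discrete_rv_measurable:
  assumes "discrete_rv M X"
  shows "X \<in> M \<rightarrow>\<^sub>M count_space UNIV"
proof (rule measurableI)
  fix A :: "'b set"
  have "X -` A \<inter> space M = (\<Union>v\<in>A \<inter> X ` space M. {x \<in> space M. X x = v})" by auto
  also have "\<dots> \<in> sets M"
    using assms by (intro sets.countable_UN'') (auto simp: discrete_rv_def)
  finally show "X -` A \<inter> space M \<in> sets M" .
qed auto

lemma discrete_rv_fun_measurable:
  fixes f :: "'b \<Rightarrow> real"
  assumes "discrete_rv M X"
  shows "(\<lambda>x. f (X x)) \<in> borel_measurable M"
  using measurable_compose[OF discrete_rv_measurable[OF assms], of f borel] by simp

lemma discrete_rv_Pair:
  assumes "discrete_rv M X" "discrete_rv M Y"
  shows "discrete_rv M (\<lambda>x. (X x, Y x))"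
proof -
  have "(\<lambda>x. (X x, Y x)) ` space M \<subseteq> X ` space M \<times> Y ` space M" by auto
  then have "countable ((\<lambda>x. (X x, Y x)) ` space M)"
    using assms by (meson countable_SIGMA countable_subset discrete_rv_def)
  moreover have "{x \<in> space M. (X x, Y x) = v} \<in> sets M" for v
  proof -
    have "{x \<in> space M. (X x, Y x) = v} = {x \<in> space M. X x = fst v} \<inter> {x \<in> space M. Y x = snd v}"
      by (auto simp: prod_eq_iff)
    then show ?thesis using assms by (auto simp: discrete_rv_def)
  qed
  ultimately show ?thesis by (auto simp: discrete_rv_def)
qed

lemma nn_integral_discrete:
  assumes "discrete_rv M X"
  shows "(\<integral>\<^sup>+x. \<phi> (X x) \<partial>M) = (\<integral>\<^sup>+v. \<phi> v * emeasure M {x \<in> space M. X x = v} \<partial>count_space UNIV)"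
proof -
  let ?V = "X ` space M"
  have V: "countable ?V" and S [measurable]: "\<And>v. {x \<in> space M. X x = v} \<in> sets M"
    using assms by (auto simp: discrete_rv_def)
  have "(\<integral>\<^sup>+x. \<phi> (X x) \<partial>M) =
      (\<integral>\<^sup>+x. (\<integral>\<^sup>+v. \<phi> v * indicator {x \<in> space M. X x = v} x \<partial>count_space ?V) \<partial>M)"
  proof (rule nn_integral_cong)
    fix x assume x: "x \<in> space M"
    have "(\<integral>\<^sup>+v. \<phi> v * indicator {x \<in> space M. X x = v} x \<partial>count_space ?V) =
        (\<integral>\<^sup>+v. \<phi> v * indicator {X x} v \<partial>count_space ?V)"
      using x by (intro nn_integral_cong) (auto simp: indicator_def)
    also have "\<dots> = \<phi> (X x)"
      using x by (subst nn_integral_indicator_singleton) auto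
    finally show "\<phi> (X x) = (\<integral>\<^sup>+v. \<phi> v * indicator {x \<in> space M. X x = v} x \<partial>count_space ?V)" by simp
  qed
  also have "\<dots> = (\<integral>\<^sup>+v. (\<integral>\<^sup>+x. \<phi> v * indicator {x \<in> space M. X x = v} x \<partial>M) \<partial>count_space ?V)"
    by (rule nn_integral_count_space_nn_integral[OF V]) measurable
  also have "\<dots> = (\<integral>\<^sup>+v. \<phi> v * emeasure M {x \<in> space M. X x = v} \<partial>count_space ?V)"
    by (intro nn_integral_cong nn_integral_cmult_indicator) auto
  also have "\<dots> = (\<integral>\<^sup>+v. \<phi> v * emeasure M {x \<in> space M. X x = v} * indicator ?V v \<partial>count_space UNIV)"
    by (simp add: nn_integral_count_space_indicator)
  also have "\<dots> = (\<integral>\<^sup>+v. \<phi> v * emeasure M {x \<in> space M. X x = v} \<partial>count_space UNIV)"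
  proof (rule nn_integral_cong)
    fix v
    have "{x \<in> space M. X x = v} = {}" if "v \<notin> ?V" using that by auto
    then show "\<phi> v * emeasure M {x \<in> space M. X x = v} * indicator ?V v =
        \<phi> v * emeasure M {x \<in> space M. X x = v}"
      by (cases "v \<in> ?V") (simp_all only: emeasure_empty indicator_simps mult_zero_right mult_1_right not_False_eq_True)
  qed
  finally show ?thesis .
qed

lemma sum_emeasure_fibres:
  assumes "discrete_rv M X" "discrete_rv M Y"
  shows "(\<integral>\<^sup>+v. emeasure M {x \<in> space M. X x = v \<and> Y x = w} \<partial>count_space UNIV) =
    emeasure M {x \<in> space M. Y x = w}"
proof -
  note XY = discrete_rv_Pair[OF assms]
  have S: "{x \<in> space M. Y x = w} \<in> sets M" using assms by (auto simp: discrete_rv_def)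
  have "emeasure M {x \<in> space M. Y x = w} = (\<integral>\<^sup>+x. indicator {x \<in> space M. Y x = w} x \<partial>M)"
    using S by simp
  also have "\<dots> = (\<integral>\<^sup>+x. indicator {w} (snd (X x, Y x)) \<partial>M)"
    by (intro nn_integral_cong) (auto simp: indicator_def)
  also have "\<dots> = (\<integral>\<^sup>+u. indicator {w} (snd u) * emeasure M {x \<in> space M. (X x, Y x) = u} \<partial>count_space UNIV)"
    by (rule nn_integral_discrete[OF XY])
  also have "\<dots> = (\<integral>\<^sup>+v. (\<integral>\<^sup>+w'. emeasure M {x \<in> space M. X x = v \<and> Y x = w'} * indicator {w} w'
      \<partial>count_space UNIV) \<partial>count_space UNIV)"
    by (subst nn_integral_fst_count_space[symmetric]) (simp add: mult.commute)
  also have "\<dots> = (\<integral>\<^sup>+v. emeasure M {x \<in> space M. X x = v \<and> Y x = w} \<partial>count_space UNIV)"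
    by (simp add: nn_integral_indicator_singleton)
  finally show ?thesis ..
qed

lemma atom_prob_measurable:
  assumes "discrete_rv M X"
  shows "atom_prob M X \<in> borel_measurable M"
  using discrete_rv_fun_measurable[OF assms, of "\<lambda>v. measure M {y \<in> space M. X y = v}"]
  by (simp add: atom_prob_def[abs_def])

text \<open>
  Atom probabilities and entropy depend only on the partition into level sets. This is how
  \<open>(X\<^sub>A, X\<^sub>B)\<close> is replaced by the restriction to \<open>A \<union> B\<close> without any relabelling of values.
\<close>

lemma atom_prob_cong:
  assumes "\<And>x y. x \<in> space M \<Longrightarrow> y \<in> space M \<Longrightarrow> X x = X y \<longleftrightarrow> X' x = X' y" "x \<in> space M"
  shows "atom_prob M X x = atom_prob M X' x"
proof -
  have "{y \<in> space M. X y = X x} = {y \<in> space M. X' y = X' x}" using assms by blast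
  then show ?thesis by (simp add: atom_prob_def)
qed

lemma rv_entropy_cong:
  assumes "\<And>x y. x \<in> space M \<Longrightarrow> y \<in> space M \<Longrightarrow> X x = X y \<longleftrightarrow> X' x = X' y"
  shows "rv_entropy M X = rv_entropy M X'"
proof -
  have "atom_prob M X x = atom_prob M X' x" if "x \<in> space M" for x
    using assms that by (intro atom_prob_cong)
  then show ?thesis unfolding rv_entropy_def by (intro nn_integral_cong) simp
qed

context prob_space begin

lemma atom_prob_pos:
  assumes "discrete_rv M X"
  shows "AE x in M. 0 < atom_prob M X x"
proof -
  let ?N = "{v \<in> X ` space M. measure M {y \<in> space M. X y = v} = 0}"
  have "AE x in M. \<forall>v\<in>?N. x \<notin> {y \<in> space M. X y = v}"
  proof (subst AE_ball_countable)
    show "countable ?N" using assms by (auto simp: discrete_rv_def)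
    show "\<forall>v\<in>?N. AE x in M. x \<notin> {y \<in> space M. X y = v}"
      using assms by (intro ballI AE_not_in null_setsI) (auto simp: discrete_rv_def emeasure_eq_measure)
  qed
  then show ?thesis
    using AE_space by eventually_elim (auto simp: atom_prob_def zero_less_measure_iff measure_nonneg less_le)
qed

lemma atom_prob_le_1: "atom_prob M X x \<le> 1"
  by (simp add: atom_prob_def)

lemma rv_entropy_eq_sum:
  assumes "discrete_rv M X"
  shows "rv_entropy M X = (\<integral>\<^sup>+v. ennreal (- (prob {x \<in> space M. X x = v} * ln (prob {x \<in> space M. X x = v})))
    \<partial>count_space UNIV)"
proof -
  have "rv_entropy M X = (\<integral>\<^sup>+x. (\<lambda>v. ennreal (- ln (prob {y \<in> space M. X y = v}))) (X x) \<partial>M)"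
    by (simp add: rv_entropy_def atom_prob_def)
  also have "\<dots> = (\<integral>\<^sup>+v. ennreal (- ln (prob {y \<in> space M. X y = v})) * emeasure M {x \<in> space M. X x = v}
      \<partial>count_space UNIV)"
    by (rule nn_integral_discrete[OF assms])
  also have "\<dots> = (\<integral>\<^sup>+v. ennreal (- (prob {x \<in> space M. X x = v} * ln (prob {x \<in> space M. X x = v})))
    \<partial>count_space UNIV)"
  proof (rule nn_integral_cong)
    fix v
    have "0 \<le> - ln (prob {y \<in> space M. X y = v})"
      by (cases "prob {y \<in> space M. X y = v} = 0") (auto simp: ln_le_zero_iff zero_less_measure_iff)
    then show "ennreal (- ln (prob {y \<in> space M. X y = v})) * emeasure M {x \<in> space M. X x = v} =
      ennreal (- (prob {x \<in> space M. X x = v} * ln (prob {x \<in> space M. X x = v})))"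
      by (simp add: emeasure_eq_measure ennreal_mult'[symmetric] mult.commute)
  qed
  finally show ?thesis .
qed

text \<open>
  The integrand is \<open>q / p\<close>, where \<open>p\<close> is the law of \<open>(X, Y, Z)\<close> and \<open>q\<close> is the law under
  which \<open>X\<close> and \<open>Y\<close> have the same joint laws with \<open>Z\<close> but are conditionally independent
  given \<open>Z\<close>. Its expectation is the \<open>q\<close>-mass of the support of \<open>p\<close>, hence at most 1 and
  possibly smaller.
\<close>

lemma expectation_likelihood_ratio_le_1:
  fixes X :: "'a \<Rightarrow> 'x" and Y :: "'a \<Rightarrow> 'y" and Z :: "'a \<Rightarrow> 'z"
  assumes X: "discrete_rv M X" and Y: "discrete_rv M Y" and Z: "discrete_rv M Z"
  shows "(\<integral>\<^sup>+x. ennreal (atom_prob M (\<lambda>x. (X x, Z x)) x * atom_prob M (\<lambda>x. (Y x, Z x)) x /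
    (atom_prob M (\<lambda>x. (X x, Y x, Z x)) x * atom_prob M Z x)) \<partial>M) \<le> 1"
proof -
  define p where "p z = prob {x \<in> space M. Z x = z}" for z
  define a where "a z u = prob {x \<in> space M. X x = u \<and> Z x = z}" for z u
  define b where "b z v = prob {x \<in> space M. Y x = v \<and> Z x = z}" for z v
  define t where "t w = prob {x \<in> space M. (Z x, X x, Y x) = w}" for w
  have T: "discrete_rv M (\<lambda>x. (Z x, X x, Y x))" using X Y Z by (intro discrete_rv_Pair)
  have [simp]: "p z \<ge> 0" "a z u \<ge> 0" "b z v \<ge> 0" "t w \<ge> 0" for z u v w
    by (simp_all add: p_def a_def b_def t_def)
  have "(\<integral>\<^sup>+x. ennreal (atom_prob M (\<lambda>x. (X x, Z x)) x * atom_prob M (\<lambda>x. (Y x, Z x)) x /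
      (atom_prob M (\<lambda>x. (X x, Y x, Z x)) x * atom_prob M Z x)) \<partial>M) =
    (\<integral>\<^sup>+x. (\<lambda>(z, u, v). ennreal (a z u * b z v / (t (z, u, v) * p z))) (Z x, X x, Y x) \<partial>M)"
    by (simp add: atom_prob_def a_def b_def t_def p_def conj_ac)
  also have "\<dots> = (\<integral>\<^sup>+w. (\<lambda>(z, u, v). ennreal (a z u * b z v / (t (z, u, v) * p z))) w * ennreal (t w)
      \<partial>count_space UNIV)"
    unfolding t_def emeasure_eq_measure[symmetric] by (rule nn_integral_discrete[OF T])
  also have "\<dots> \<le> (\<integral>\<^sup>+w. (\<lambda>(z, u, v). ennreal (1 / p z) * ennreal (a z u) * ennreal (b z v)) w \<partial>count_space UNIV)"
  proof (rule nn_integral_mono, clarify)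
    fix z u v
    have "a z u * b z v / (t (z, u, v) * p z) * t (z, u, v) \<le> 1 / p z * a z u * b z v"
      by (cases "t (z, u, v) = 0") (auto simp: field_simps)
    then show "ennreal (a z u * b z v / (t (z, u, v) * p z)) * ennreal (t (z, u, v)) \<le>
        ennreal (1 / p z) * ennreal (a z u) * ennreal (b z v)"
      by (simp add: ennreal_mult[symmetric] ennreal_leI)
  qed
  also have "\<dots> = (\<integral>\<^sup>+z. (\<integral>\<^sup>+u. (\<integral>\<^sup>+v. ennreal (1 / p z) * ennreal (a z u) * ennreal (b z v)
      \<partial>count_space UNIV) \<partial>count_space UNIV) \<partial>count_space UNIV)"
    by (simp add: nn_integral_fst_count_space[symmetric])
  also have "\<dots> = (\<integral>\<^sup>+z. ennreal (1 / p z) * ennreal (p z) * ennreal (p z) \<partial>count_space UNIV)"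
  proof (rule nn_integral_cong)
    fix z
    have "(\<integral>\<^sup>+v. ennreal (b z v) \<partial>count_space UNIV) = ennreal (p z)"
      and "(\<integral>\<^sup>+u. ennreal (a z u) \<partial>count_space UNIV) = ennreal (p z)"
      unfolding a_def b_def p_def emeasure_eq_measure[symmetric]
      by (simp_all add: sum_emeasure_fibres X Y Z)
    then show "(\<integral>\<^sup>+u. (\<integral>\<^sup>+v. ennreal (1 / p z) * ennreal (a z u) * ennreal (b z v)
        \<partial>count_space UNIV) \<partial>count_space UNIV) = ennreal (1 / p z) * ennreal (p z) * ennreal (p z)"
      by (simp add: nn_integral_cmult nn_integral_multc)
  qed
  also have "\<dots> = (\<integral>\<^sup>+z. emeasure M {x \<in> space M. Z x = z} \<partial>count_space UNIV)"
    by (intro nn_integral_cong) (auto simp: ennreal_mult'[symmetric] p_def emeasure_eq_measure)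
  also have "\<dots> = 1"
    using nn_integral_discrete[OF Z, of "\<lambda>_. 1"] emeasure_space_1 by simp
  finally show ?thesis .
qed

text \<open>
  With \<open>R\<close> the ratio in \<open>expectation_likelihood_ratio_le_1\<close>, \<open>ln R = R - 1 - d\<close> where
  \<open>d \<ge> 0\<close> vanishes exactly where \<open>R = 1\<close>. Integrating this identity, rearranged so that all
  terms are nonnegative, makes sense for infinite entropies too, which yields finiteness of
  joint entropies later on. The remainder \<open>d\<close> is kept for the equality case.
\<close>

lemma rv_entropy_submodular_gap:
  assumes X: "discrete_rv M X" and Y: "discrete_rv M Y" and Z: "discrete_rv M Z"
  obtains d where "(\<lambda>x. ennreal (d x)) \<in> borel_measurable M"
    "rv_entropy M (\<lambda>x. (X x, Y x, Z x)) + rv_entropy M Z + (\<integral>\<^sup>+x. ennreal (d x) \<partial>M) \<le>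
      rv_entropy M (\<lambda>x. (X x, Z x)) + rv_entropy M (\<lambda>x. (Y x, Z x))"
    "AE x in M. d x \<ge> 0 \<and> (d x = 0 \<longleftrightarrow>
       atom_prob M (\<lambda>x. (X x, Z x)) x * atom_prob M (\<lambda>x. (Y x, Z x)) x =
       atom_prob M (\<lambda>x. (X x, Y x, Z x)) x * atom_prob M Z x)"
proof -
  note rvs = discrete_rv_Pair[OF X Z] discrete_rv_Pair[OF Y Z]
    discrete_rv_Pair[OF X discrete_rv_Pair[OF Y Z]] Z
  let ?a = "atom_prob M (\<lambda>x. (X x, Z x))" and ?b = "atom_prob M (\<lambda>x. (Y x, Z x))"
  let ?t = "atom_prob M (\<lambda>x. (X x, Y x, Z x))" and ?p = "atom_prob M Z"
  define R where "R x = ?a x * ?b x / (?t x * ?p x)" for x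
  define d where "d x = R x - 1 - ln (R x)" for x
  have [measurable]: "?a \<in> borel_measurable M" "?b \<in> borel_measurable M"
    "?t \<in> borel_measurable M" "?p \<in> borel_measurable M"
    using rvs by (auto intro: atom_prob_measurable)
  have [measurable]: "R \<in> borel_measurable M" "d \<in> borel_measurable M"
    unfolding R_def d_def by measurable
  have pos: "AE x in M. 0 < ?a x \<and> 0 < ?b x \<and> 0 < ?t x \<and> 0 < ?p x"
    using rvs[THEN atom_prob_pos] by auto
  have d_pos: "AE x in M. d x \<ge> 0 \<and> (d x = 0 \<longleftrightarrow> ?a x * ?b x = ?t x * ?p x)"
    using pos
  proof eventually_elim
    fix x assume x: "0 < ?a x \<and> 0 < ?b x \<and> 0 < ?t x \<and> 0 < ?p x"
    then have "R x > 0" by (simp add: R_def)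
    moreover have "R x = 1 \<longleftrightarrow> ?a x * ?b x = ?t x * ?p x" using x by (auto simp: R_def field_simps)
    ultimately show "d x \<ge> 0 \<and> (d x = 0 \<longleftrightarrow> ?a x * ?b x = ?t x * ?p x)"
      using ln_le_minus_one[of "R x"] ln_eq_minus_one[of "R x"] by (auto simp: d_def)
  qed
  have "(\<integral>\<^sup>+x. ennreal (- ln (?t x)) + ennreal (- ln (?p x)) + ennreal (d x) + 1 \<partial>M) =
        (\<integral>\<^sup>+x. ennreal (- ln (?a x)) + ennreal (- ln (?b x)) + ennreal (R x) \<partial>M)"
  proof (rule nn_integral_cong_AE)
    show "AE x in M. ennreal (- ln (?t x)) + ennreal (- ln (?p x)) + ennreal (d x) + 1 =
        ennreal (- ln (?a x)) + ennreal (- ln (?b x)) + ennreal (R x)"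
      using pos d_pos
    proof eventually_elim
      fix x assume x: "0 < ?a x \<and> 0 < ?b x \<and> 0 < ?t x \<and> 0 < ?p x"
        and d: "d x \<ge> 0 \<and> (d x = 0 \<longleftrightarrow> ?a x * ?b x = ?t x * ?p x)"
      have "ln (?t x) \<le> 0" "ln (?p x) \<le> 0" "ln (?a x) \<le> 0" "ln (?b x) \<le> 0"
        using x atom_prob_le_1 by auto
      moreover have "- ln (?t x) + - ln (?p x) + d x + 1 = - ln (?a x) + - ln (?b x) + R x"
        using x by (simp add: d_def R_def ln_div ln_mult)
      moreover have "R x \<ge> 0" using x by (simp add: R_def)
      ultimately show "ennreal (- ln (?t x)) + ennreal (- ln (?p x)) + ennreal (d x) + 1 =
        ennreal (- ln (?a x)) + ennreal (- ln (?b x)) + ennreal (R x)"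
        using d by (simp add: ennreal_plus[symmetric] flip: ennreal_1 del: ennreal_plus)
    qed
  qed
  then have "rv_entropy M (\<lambda>x. (X x, Y x, Z x)) + rv_entropy M Z + (\<integral>\<^sup>+x. ennreal (d x) \<partial>M) + 1 =
      rv_entropy M (\<lambda>x. (X x, Z x)) + rv_entropy M (\<lambda>x. (Y x, Z x)) + (\<integral>\<^sup>+x. ennreal (R x) \<partial>M)"
    by (simp add: nn_integral_add rv_entropy_def emeasure_space_1)
  also have "\<dots> \<le> rv_entropy M (\<lambda>x. (X x, Z x)) + rv_entropy M (\<lambda>x. (Y x, Z x)) + 1"
    using expectation_likelihood_ratio_le_1[OF X Y Z] by (intro add_left_mono) (simp add: R_def)
  finally have "rv_entropy M (\<lambda>x. (X x, Y x, Z x)) + rv_entropy M Z + (\<integral>\<^sup>+x. ennreal (d x) \<partial>M) \<le>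
      rv_entropy M (\<lambda>x. (X x, Z x)) + rv_entropy M (\<lambda>x. (Y x, Z x))"
    using ennreal_add_left_cancel_le[of 1] by (simp add: add.commute)
  then show ?thesis using d_pos by (intro that[of d]) auto
qed

lemma rv_entropy_submodular:
  assumes "discrete_rv M X" "discrete_rv M Y" "discrete_rv M Z"
  shows "rv_entropy M (\<lambda>x. (X x, Y x, Z x)) + rv_entropy M Z \<le>
    rv_entropy M (\<lambda>x. (X x, Z x)) + rv_entropy M (\<lambda>x. (Y x, Z x))"
  using rv_entropy_submodular_gap[OF assms] by (meson order_trans le_iff_add)

text \<open>
  If the sums are equal and finite, the gap \<open>d\<close> of \<open>rv_entropy_submodular_gap\<close> has integral
  0, hence vanishes almost everywhere.
\<close>

lemma rv_entropy_modular_iff: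
  assumes X: "discrete_rv M X" and Y: "discrete_rv M Y" and Z: "discrete_rv M Z"
    and fin: "rv_entropy M (\<lambda>x. (X x, Z x)) < \<infinity>" "rv_entropy M (\<lambda>x. (Y x, Z x)) < \<infinity>"
  shows "rv_entropy M (\<lambda>x. (X x, Y x, Z x)) + rv_entropy M Z =
      rv_entropy M (\<lambda>x. (X x, Z x)) + rv_entropy M (\<lambda>x. (Y x, Z x)) \<longleftrightarrow>
    (AE x in M. atom_prob M (\<lambda>x. (X x, Z x)) x * atom_prob M (\<lambda>x. (Y x, Z x)) x =
       atom_prob M (\<lambda>x. (X x, Y x, Z x)) x * atom_prob M Z x)" (is "?l = ?r \<longleftrightarrow> ?ae")
proof
  assume eq: "?l = ?r"
  obtain d where d: "(\<lambda>x. ennreal (d x)) \<in> borel_measurable M"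
    "?l + (\<integral>\<^sup>+x. ennreal (d x) \<partial>M) \<le> ?r"
    "AE x in M. d x \<ge> 0 \<and> (d x = 0 \<longleftrightarrow>
       atom_prob M (\<lambda>x. (X x, Z x)) x * atom_prob M (\<lambda>x. (Y x, Z x)) x =
       atom_prob M (\<lambda>x. (X x, Y x, Z x)) x * atom_prob M Z x)"
    using rv_entropy_submodular_gap[OF X Y Z] by blast
  have "?r < \<infinity>" using fin by simp
  then have "(\<integral>\<^sup>+x. ennreal (d x) \<partial>M) = 0"
    using d(2) eq ennreal_add_left_cancel_le[of ?r "(\<integral>\<^sup>+x. ennreal (d x) \<partial>M)" 0] by auto
  then have "AE x in M. ennreal (d x) = 0"
    using d(1) by (simp add: nn_integral_0_iff_AE)
  then show ?ae using d(3) by eventually_elim (auto simp: ennreal_eq_0_iff)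
next
  assume ae: ?ae
  note rvs = discrete_rv_Pair[OF X Z] discrete_rv_Pair[OF Y Z]
    discrete_rv_Pair[OF X discrete_rv_Pair[OF Y Z]] Z
  have "AE x in M. ennreal (- ln (atom_prob M (\<lambda>x. (X x, Y x, Z x)) x)) + ennreal (- ln (atom_prob M Z x)) =
      ennreal (- ln (atom_prob M (\<lambda>x. (X x, Z x)) x)) + ennreal (- ln (atom_prob M (\<lambda>x. (Y x, Z x)) x))"
    using ae rvs[THEN atom_prob_pos]
  proof eventually_elim
    case (elim x)
    then have "ln (atom_prob M (\<lambda>x. (X x, Z x)) x) + ln (atom_prob M (\<lambda>x. (Y x, Z x)) x) =
        ln (atom_prob M (\<lambda>x. (X x, Y x, Z x)) x) + ln (atom_prob M Z x)"
      using ln_mult_pos[OF elim(2,3)] ln_mult_pos[OF elim(4,5)] by simp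
    then have "- ln (atom_prob M (\<lambda>x. (X x, Y x, Z x)) x) + - ln (atom_prob M Z x) =
        - ln (atom_prob M (\<lambda>x. (X x, Z x)) x) + - ln (atom_prob M (\<lambda>x. (Y x, Z x)) x)"
      by linarith
    moreover have "- ln (atom_prob M (\<lambda>x. (X x, Y x, Z x)) x) \<ge> 0" "- ln (atom_prob M Z x) \<ge> 0"
       "- ln (atom_prob M (\<lambda>x. (X x, Z x)) x) \<ge> 0" "- ln (atom_prob M (\<lambda>x. (Y x, Z x)) x) \<ge> 0"
      using elim atom_prob_le_1 by auto
    ultimately show ?case by (simp add: ennreal_plus[symmetric] del: ennreal_plus)
  qed
  note eq = nn_integral_cong_AE[OF this]
  note [measurable] = rvs[THEN atom_prob_measurable]
  from eq show "?l = ?r"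
    unfolding rv_entropy_def by (subst (asm) (1 2) nn_integral_add; measurable)
qed

text \<open>
  The variable sending a point to its level set of \<open>X\<close> takes values in \<open>P\<close>, so the sum over
  \<open>P\<close> is its entropy. The assumption on cells leaves room for an empty cell.
\<close>

lemma partition_entropy_eq_rv_entropy:
  assumes X: "discrete_rv M X"
    and cell: "\<And>A x. A \<in> P \<Longrightarrow> x \<in> A \<Longrightarrow> A = {y \<in> space M. X y = X x}"
    and cover: "space M \<subseteq> \<Union>P"
  shows "partition_entropy M P = rv_entropy M X"
proof -
  define C where "C x = {y \<in> space M. X y = X x}" for x
  have C_fibre: "{x \<in> space M. C x = A} = (if A \<in> P then A else {})" for A
  proof -
    have "C x \<in> P" if "x \<in> space M" for x using cell cover that unfolding C_def by blast
    moreover have "A \<in> P \<Longrightarrow> {x \<in> space M. C x = A} = A" using cell[of A] unfolding C_def by blast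
    ultimately show ?thesis by auto
  qed
  have "discrete_rv M C"
    unfolding discrete_rv_def
  proof
    have "C ` space M = (\<lambda>v. {y \<in> space M. X y = v}) ` X ` space M" by (auto simp: C_def)
    then show "countable (C ` space M)" using X by (auto simp: discrete_rv_def)
    have "A \<in> sets M" if "A \<in> P" for A
      using cell[OF that] X by (cases "A = {}") (auto simp: discrete_rv_def)
    then show "\<forall>A. {x \<in> space M. C x = A} \<in> sets M" by (simp add: C_fibre)
  qed
  then have "rv_entropy M C = (\<integral>\<^sup>+A. ennreal (- (measure M A * ln (measure M A))) * indicator P A \<partial>count_space UNIV)"
    by (subst rv_entropy_eq_sum) (auto simp: C_fibre intro!: nn_integral_cong)
  also have "\<dots> = partition_entropy M P"
    by (simp add: partition_entropy_def nn_integral_count_space_indicator)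
  finally have "rv_entropy M C = partition_entropy M P" .
  moreover have "rv_entropy M C = rv_entropy M X"
    by (rule rv_entropy_cong) (auto simp: C_def)
  ultimately show ?thesis by simp
qed

end

section \<open>Partitions determined by finitely many sites\<close>

text \<open>
  The cells are the classes of configurations agreeing on \<open>W\<close>, except that empty cells may
  be present or not: a join contains the empty set as soon as two cells are disjoint.
\<close>

definition observed_partition ::
    "('g, 'm) monoid_scheme \<Rightarrow> 'k set \<Rightarrow> 'g set \<Rightarrow> ('g \<Rightarrow> 'k) set set \<Rightarrow> bool" where
  "observed_partition G K W P \<longleftrightarrow> configs G K \<subseteq> \<Union>P \<and>
     (\<forall>A\<in>P. \<forall>x\<in>A. A = {y \<in> configs G K. \<forall>w\<in>W. y w = x w})"

lemma observed_partitionD: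
  assumes "observed_partition G K W P" "A \<in> P" "x \<in> A"
  shows "y \<in> A \<longleftrightarrow> y \<in> configs G K \<and> (\<forall>w\<in>W. y w = x w)"
  using assms unfolding observed_partition_def by blast

lemma observed_partitionI:
  assumes "\<And>x. x \<in> configs G K \<Longrightarrow> \<exists>A\<in>P. x \<in> A"
    and "\<And>A x y. A \<in> P \<Longrightarrow> x \<in> A \<Longrightarrow> y \<in> A \<longleftrightarrow> y \<in> configs G K \<and> (\<forall>w\<in>W. y w = x w)"
  shows "observed_partition G K W P"
  unfolding observed_partition_def
proof (intro conjI ballI)
  show "configs G K \<subseteq> \<Union>P" using assms(1) by blast
next
  fix A x assume "A \<in> P" "x \<in> A"
  then show "A = {y \<in> configs G K. \<forall>w\<in>W. y w = x w}" using assms(2) by blast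
qed

lemma observed_partition_coverE:
  assumes "observed_partition G K W P" "x \<in> configs G K"
  obtains A where "A \<in> P" "x \<in> A"
  using assms unfolding observed_partition_def by blast

lemma observed_partition_join:
  assumes P: "observed_partition G K V P" and Q: "observed_partition G K W Q"
  shows "observed_partition G K (V \<union> W) (partition_join P Q)"
proof (rule observed_partitionI)
  fix x assume x: "x \<in> configs G K"
  obtain A B where "A \<in> P" "x \<in> A" "B \<in> Q" "x \<in> B"
    using observed_partition_coverE[OF P x] observed_partition_coverE[OF Q x] by metis
  then have "A \<inter> B \<in> partition_join P Q" "x \<in> A \<inter> B" by (auto simp: partition_join_def)
  then show "\<exists>C\<in>partition_join P Q. x \<in> C" by blast
next
  fix C x y assume "C \<in> partition_join P Q" and x: "x \<in> C"
  then obtain A B where C: "C = A \<inter> B" "A \<in> P" "B \<in> Q" by (auto simp: partition_join_def)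
  then show "y \<in> C \<longleftrightarrow> y \<in> configs G K \<and> (\<forall>w\<in>V \<union> W. y w = x w)"
    using observed_partitionD[OF P C(2), of x y] observed_partitionD[OF Q C(3), of x y] x by auto
qed

lemma observed_partition_Join:
  assumes P: "\<And>i. i \<in> I \<Longrightarrow> observed_partition G K (W i) (P i)" and "I \<noteq> {}"
  shows "observed_partition G K (\<Union>i\<in>I. W i) (partition_Join I P)"
proof (rule observed_partitionI)
  fix x assume x: "x \<in> configs G K"
  have "\<forall>i\<in>I. \<exists>A. A \<in> P i \<and> x \<in> A" using observed_partition_coverE[OF P x] by metis
  then obtain C where C: "\<forall>i\<in>I. C i \<in> P i \<and> x \<in> C i" by metis
  then have "(\<Inter>i\<in>I. C i) \<in> partition_Join I P" by (auto simp: partition_Join_def)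
  with C show "\<exists>A\<in>partition_Join I P. x \<in> A" by blast
next
  fix A x y assume "A \<in> partition_Join I P" and x: "x \<in> A"
  then obtain C where C: "A = (\<Inter>i\<in>I. C i)" "\<forall>i\<in>I. C i \<in> P i" by (auto simp: partition_Join_def)
  have "y \<in> C i \<longleftrightarrow> y \<in> configs G K \<and> (\<forall>w\<in>W i. y w = x w)" if "i \<in> I" for i
    using that observed_partitionD[OF P[OF that], of "C i" x y] C x by blast
  then show "y \<in> A \<longleftrightarrow> y \<in> configs G K \<and> (\<forall>w\<in>(\<Union>i\<in>I. W i). y w = x w)"
    using C(1) \<open>I \<noteq> {}\<close> by auto
qed

lemma observed_partition_canonical:
  assumes "monoid G"
  shows "observed_partition G K {\<one>\<^bsub>G\<^esub>} (canonical_partition G K)"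
proof (rule observed_partitionI)
  fix x assume x: "x \<in> configs G K"
  then have "x \<one>\<^bsub>G\<^esub> \<in> K" using monoid.one_closed[OF assms] by (auto simp: configs_def)
  then show "\<exists>A\<in>canonical_partition G K. x \<in> A" using x by (auto simp: canonical_partition_def)
qed (auto simp: canonical_partition_def)

lemma act_configs: "monoid G \<Longrightarrow> g \<in> carrier G \<Longrightarrow> x \<in> configs G K \<Longrightarrow> act G g x \<in> configs G K"
  by (auto simp: act_def configs_def monoid.m_closed)

text \<open>
  The action multiplies sites on the right, so pulling back along \<open>g\<close> shifts the observed
  sites from \<open>W\<close> to \<open>Wg\<close>.
\<close>

lemma observed_partition_pullback:
  fixes G :: "('g, 'm) monoid_scheme" and K :: "'k set"
  assumes "monoid G" "g \<in> carrier G" "W \<subseteq> carrier G" and P: "observed_partition G K W P"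
  shows "observed_partition G K ((\<lambda>w. w \<otimes>\<^bsub>G\<^esub> g) ` W) (pullback_partition G K g P)"
proof -
  have act: "act G g x w = x (w \<otimes>\<^bsub>G\<^esub> g)" if "w \<in> W" for w and x :: "'g \<Rightarrow> 'k" using assms(3) that by (auto simp: act_def)
  note act_in = act_configs[OF assms(1,2)]
  show ?thesis
  proof (rule observed_partitionI)
    fix x assume x: "x \<in> configs G K"
    obtain A where "A \<in> P" "act G g x \<in> A" using observed_partition_coverE[OF P act_in[OF x]] .
    then have "act_preimage G K g A \<in> pullback_partition G K g P" "x \<in> act_preimage G K g A"
      using x by (auto simp: pullback_partition_def act_preimage_def)
    then show "\<exists>A\<in>pullback_partition G K g P. x \<in> A" by blast
  next
    fix B x y assume "B \<in> pullback_partition G K g P" and x: "x \<in> B"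
    then obtain A where A: "B = act_preimage G K g A" "A \<in> P" by (auto simp: pullback_partition_def)
    then show "y \<in> B \<longleftrightarrow> y \<in> configs G K \<and> (\<forall>w\<in>(\<lambda>w. w \<otimes>\<^bsub>G\<^esub> g) ` W. y w = x w)"
      using observed_partitionD[OF P A(2), of "act G g x" "act G g y"] x act act_in
      by (auto simp: act_preimage_def)
  qed
qed

locale stationary_config = prob_space \<mu>
  for G :: "('g, 'm) monoid_scheme" and K :: "'k set" and \<mu> :: "('g \<Rightarrow> 'k) measure" +
  assumes monoid_G: "monoid G"
    and countable_K: "countable K"
    and sets_borel: "sets \<mu> = sets (borel_of_topology (config_topology G K))"
    and invariant: "action_invariant G K \<mu>"
    and finite_entropy: "partition_entropy \<mu> (canonical_partition G K) < \<infinity>"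
begin

interpretation G: monoid G by (rule monoid_G)

lemma space_eq: "space \<mu> = configs G K"
proof -
  have "topspace (config_topology G K) = configs G K"
    by (simp add: config_topology_def configs_def)
  moreover have "{U. openin X U} \<subseteq> Pow (topspace X)" for X :: "('g \<Rightarrow> 'k) topology"
    by (auto dest: openin_subset)
  ultimately show ?thesis
    using sets_eq_imp_space_eq[OF sets_borel] by (metis borel_of_topology_def space_measure_of)
qed

lemma coordinate_measurable:
  assumes "g \<in> carrier G"
  shows "{x \<in> space \<mu>. x g = k} \<in> sets \<mu>"
proof -
  have "openin (config_topology G K) {x \<in> topspace (config_topology G K). x g \<in> {k} \<inter> K}"
    unfolding config_topology_def using assms
    by (intro openin_continuous_map_preimage[OF continuous_map_product_projection]) auto
  moreover have "{x \<in> topspace (config_topology G K). x g \<in> {k} \<inter> K} = {x \<in> space \<mu>. x g = k}"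
    using assms unfolding space_eq by (auto simp: config_topology_def configs_def)
  moreover have "{U. openin X U} \<subseteq> sets (borel_of_topology X)" for X :: "('g \<Rightarrow> 'k) topology"
    by (auto simp: borel_of_topology_def intro: sigma_sets.Basic dest: openin_subset
        intro!: in_measure_of)
  ultimately show ?thesis using sets_borel by auto
qed

lemma restrict_eq_iff: "restrict x W = restrict y W \<longleftrightarrow> (\<forall>w\<in>W. x w = y w)"
  by (auto simp: restrict_def fun_eq_iff)

lemma discrete_rv_restrict:
  assumes "finite W" "W \<subseteq> carrier G"
  shows "discrete_rv \<mu> (\<lambda>x. restrict x W)"
proof -
  have "(\<lambda>x. restrict x W) ` space \<mu> \<subseteq> PiE W (\<lambda>_. K)"
    using assms unfolding space_eq configs_def by (auto simp: PiE_iff Pi_iff)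
  then have "countable ((\<lambda>x. restrict x W) ` space \<mu>)"
    using countable_PiE[of W "\<lambda>_. K"] assms countable_K by (meson countable_subset)
  moreover have "{x \<in> space \<mu>. restrict x W = v} \<in> sets \<mu>" for v
  proof (cases "v \<in> extensional W")
    case True
    then have "{x \<in> space \<mu>. restrict x W = v} = {x \<in> space \<mu>. \<forall>w\<in>W. x w = v w}"
      using restrict_eq_iff[of _ W v] by (simp add: extensional_restrict)
    moreover have "{x \<in> space \<mu>. \<forall>w\<in>W. x w = v w} \<in> sets \<mu>"
      using assms by (intro sets.sets_Collect_finite_All coordinate_measurable) auto
    ultimately show ?thesis by simp
  next
    case False
    then have "{x \<in> space \<mu>. restrict x W = v} = {}" by auto
    then show ?thesis by (simp only: sets.empty_sets)
  qed
  ultimately show ?thesis by (simp add: discrete_rv_def)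
qed

definition site_entropy :: "'g set \<Rightarrow> ennreal" where
  "site_entropy W = rv_entropy \<mu> (\<lambda>x. restrict x W)"

definition site_prob :: "'g set \<Rightarrow> ('g \<Rightarrow> 'k) \<Rightarrow> real" where
  "site_prob W = atom_prob \<mu> (\<lambda>x. restrict x W)"

lemma site_prob_eq: "site_prob W x = prob {y \<in> space \<mu>. \<forall>w\<in>W. y w = x w}"
  by (simp add: site_prob_def atom_prob_def restrict_eq_iff)

lemma observed_partition_entropy:
  assumes "finite W" "W \<subseteq> carrier G" "observed_partition G K W P"
  shows "partition_entropy \<mu> P = site_entropy W"
  unfolding site_entropy_def
proof (rule partition_entropy_eq_rv_entropy)
  show "discrete_rv \<mu> (\<lambda>x. restrict x W)" using assms by (intro discrete_rv_restrict)
qed (use assms in \<open>auto simp: observed_partition_def space_eq restrict_eq_iff\<close>)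

lemma site_triple:
  shows "rv_entropy \<mu> (\<lambda>x. (restrict x A, restrict x C)) = site_entropy (A \<union> C)"
    and "atom_prob \<mu> (\<lambda>x. (restrict x A, restrict x C)) x = site_prob (A \<union> C) x"
    and "rv_entropy \<mu> (\<lambda>x. (restrict x A, restrict x B, restrict x C)) = site_entropy (A \<union> B \<union> C)"
    and "atom_prob \<mu> (\<lambda>x. (restrict x A, restrict x B, restrict x C)) x = site_prob (A \<union> B \<union> C) x"
proof -
  show "rv_entropy \<mu> (\<lambda>x. (restrict x A, restrict x C)) = site_entropy (A \<union> C)"
    unfolding site_entropy_def by (rule rv_entropy_cong) (auto simp: restrict_eq_iff)
  show "rv_entropy \<mu> (\<lambda>x. (restrict x A, restrict x B, restrict x C)) = site_entropy (A \<union> B \<union> C)"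
    unfolding site_entropy_def by (rule rv_entropy_cong) (auto simp: restrict_eq_iff)
  show "atom_prob \<mu> (\<lambda>x. (restrict x A, restrict x C)) x = site_prob (A \<union> C) x"
    unfolding site_prob_eq atom_prob_def by (simp add: restrict_eq_iff ball_Un)
  show "atom_prob \<mu> (\<lambda>x. (restrict x A, restrict x B, restrict x C)) x = site_prob (A \<union> B \<union> C) x"
    unfolding site_prob_eq atom_prob_def by (simp add: restrict_eq_iff ball_Un conj_assoc)
qed

lemma site_entropy_submodular:
  assumes "finite A" "finite B" "A \<subseteq> carrier G" "B \<subseteq> carrier G" "C \<subseteq> A \<inter> B"
  shows "site_entropy (A \<union> B) + site_entropy C \<le> site_entropy A + site_entropy B"
proof -
  have u: "A \<union> B \<union> C = A \<union> B" "A \<union> C = A" "B \<union> C = B" using assms by auto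
  have "finite C" "C \<subseteq> carrier G" using assms finite_subset by auto
  note rvs = discrete_rv_restrict[OF assms(1,3)] discrete_rv_restrict[OF assms(2,4)]
    discrete_rv_restrict[OF this]
  show ?thesis
    by (rule rv_entropy_submodular[OF rvs, unfolded site_triple u, folded site_entropy_def])
qed

text \<open>
  The values on \<open>Wg\<close> of a configuration are those on \<open>W\<close> of its image under \<open>g\<close>, which has
  the same law by invariance.
\<close>

lemma site_entropy_translate:
  assumes "finite W" "W \<subseteq> carrier G" "g \<in> carrier G"
  shows "site_entropy ((\<lambda>w. w \<otimes>\<^bsub>G\<^esub> g) ` W) = site_entropy W"
proof -
  let ?Y = "\<lambda>x. restrict (act G g x) W"
  have act: "act G g x w = x (w \<otimes>\<^bsub>G\<^esub> g)" if "w \<in> W" for w and x :: "'g \<Rightarrow> 'k" using assms(2) that by (auto simp: act_def)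
  note X = discrete_rv_restrict[OF assms(1,2)]
  have fibre: "{x \<in> space \<mu>. ?Y x = v} = act_preimage G K g {x \<in> space \<mu>. restrict x W = v}" for v
    using act_configs[OF monoid_G assms(3)] by (auto simp: act_preimage_def space_eq)
  have meas: "act_preimage G K g {x \<in> space \<mu>. restrict x W = v} \<in> sets \<mu>" for v
  proof (cases "v \<in> extensional W")
    case True
    have "act_preimage G K g {x \<in> space \<mu>. restrict x W = v} = {x \<in> space \<mu>. \<forall>w\<in>W. x (w \<otimes>\<^bsub>G\<^esub> g) = v w}"
      unfolding fibre[symmetric] using restrict_eq_iff[of _ W v] True act
      by (auto simp: extensional_restrict)
    then show ?thesis
      using assms by (auto intro!: sets.sets_Collect_finite_All coordinate_measurable)
  next
    case False
    then have "{x \<in> space \<mu>. restrict x W = v} = {}" by auto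
    then show ?thesis by (simp only: act_preimage_def vimage_empty Int_empty_left sets.empty_sets)
  qed
  have "?Y ` space \<mu> \<subseteq> (\<lambda>x. restrict x W) ` space \<mu>"
    using act_configs[OF monoid_G assms(3)] by (auto simp: space_eq)
  then have Y: "discrete_rv \<mu> ?Y"
    using X meas unfolding discrete_rv_def fibre by (auto intro: countable_subset)
  have "emeasure \<mu> {x \<in> space \<mu>. ?Y x = v} = emeasure \<mu> {x \<in> space \<mu>. restrict x W = v}" for v
    unfolding fibre using invariant assms(3) X by (auto simp: action_invariant_def discrete_rv_def)
  then have "rv_entropy \<mu> ?Y = site_entropy W"
    unfolding site_entropy_def rv_entropy_eq_sum[OF X] rv_entropy_eq_sum[OF Y] measure_def by simp
  moreover have "rv_entropy \<mu> ?Y = site_entropy ((\<lambda>w. w \<otimes>\<^bsub>G\<^esub> g) ` W)"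
    unfolding site_entropy_def using act by (intro rv_entropy_cong) (auto simp: restrict_eq_iff)
  ultimately show ?thesis by simp
qed

lemma site_entropy_empty: "site_entropy {} = 0"
  using prob_space by (simp add: site_entropy_def rv_entropy_def atom_prob_def restrict_eq_iff)

text \<open>
  Subadditivity is submodularity over the empty set of sites.
\<close>

lemma site_entropy_finite:
  assumes "finite W" "W \<subseteq> carrier G"
  shows "site_entropy W < \<infinity>"
  using assms
proof (induction W rule: finite_induct)
  case empty
  then show ?case by (simp add: site_entropy_empty)
next
  case (insert g W)
  have "site_entropy ({g} \<union> W) + site_entropy {} \<le> site_entropy {g} + site_entropy W"
    using insert by (intro site_entropy_submodular) auto
  moreover have "site_entropy {g} = site_entropy {\<one>\<^bsub>G\<^esub>}"
    using site_entropy_translate[of "{\<one>\<^bsub>G\<^esub>}" g] insert by simp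
  moreover have "site_entropy {\<one>\<^bsub>G\<^esub>} < \<infinity>"
    using finite_entropy observed_partition_entropy[OF _ _ observed_partition_canonical[OF monoid_G]] by simp
  ultimately show ?case
    using insert by (auto simp: site_entropy_empty intro: le_less_trans)
qed

lemma site_entropy_modular_iff:
  assumes "finite A" "finite B" "A \<subseteq> carrier G" "B \<subseteq> carrier G" "C \<subseteq> A \<inter> B"
  shows "site_entropy (A \<union> B) + site_entropy C = site_entropy A + site_entropy B \<longleftrightarrow>
    (AE x in \<mu>. site_prob A x * site_prob B x = site_prob (A \<union> B) x * site_prob C x)"
proof -
  have u: "A \<union> B \<union> C = A \<union> B" "A \<union> C = A" "B \<union> C = B" using assms by auto
  have "finite C" "C \<subseteq> carrier G" using assms finite_subset by auto
  note rvs = discrete_rv_restrict[OF assms(1,3)] discrete_rv_restrict[OF assms(2,4)]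
    discrete_rv_restrict[OF this]
  show ?thesis
    by (rule rv_entropy_modular_iff[OF rvs, unfolded site_triple u,
          folded site_entropy_def site_prob_def])
      (use site_entropy_finite assms in blast)+
qed

end

section \<open>The Markov property in terms of entropy\<close>

context stationary_config
begin

interpretation G: monoid G by (rule monoid_G)

definition cylinder :: "'g set \<Rightarrow> ('g \<Rightarrow> 'k) \<Rightarrow> ('g \<Rightarrow> 'k) set" where
  "cylinder V z = {y \<in> space \<mu>. \<forall>w\<in>V. y w = z w}"

definition value_at :: "'g \<Rightarrow> 'k \<Rightarrow> ('g \<Rightarrow> 'k) set" where
  "value_at u k = {y \<in> space \<mu>. y u = k}"

text \<open>
  The explicit version of the conditional probability of \<open>X\<^sub>u = k\<close> given \<open>X\<^sub>g\<close>. It is 0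
  where the denominator is 0, which only happens on cylinders of measure 0.
\<close>

definition transition_prob :: "'g \<Rightarrow> 'k \<Rightarrow> 'g \<Rightarrow> ('g \<Rightarrow> 'k) \<Rightarrow> real" where
  "transition_prob u k g x = prob (cylinder {g} x \<inter> value_at u k) / prob (cylinder {g} x)"

abbreviation "sites_algebra I \<equiv> join_algebra G K I (canonical_partition G K)"

lemma pullback_canonical:
  assumes "g \<in> carrier G"
  shows "act_preimage G K g {x \<in> configs G K. x \<one>\<^bsub>G\<^esub> = k} = value_at g k"
    "pullback_partition G K g (canonical_partition G K) = value_at g ` K"
proof -
  show *: "act_preimage G K g {x \<in> configs G K. x \<one>\<^bsub>G\<^esub> = k} = value_at g k" for k
    using act_configs[OF monoid_G assms] assms
    by (auto simp: act_preimage_def value_at_def space_eq act_def)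
  then show "pullback_partition G K g (canonical_partition G K) = value_at g ` K"
    by (simp add: pullback_partition_def canonical_partition_def image_image)
qed

lemma value_at_sets [measurable]: "u \<in> carrier G \<Longrightarrow> value_at u k \<in> sets \<mu>"
  unfolding value_at_def by (rule coordinate_measurable)

lemma cylinder_eq_fibre: "cylinder V z = {y \<in> space \<mu>. restrict y V = restrict z V}"
  by (simp add: cylinder_def restrict_eq_iff)

lemma cylinder_sets: "finite V \<Longrightarrow> V \<subseteq> carrier G \<Longrightarrow> cylinder V z \<in> sets \<mu>"
  using discrete_rv_restrict[of V] by (simp add: cylinder_eq_fibre discrete_rv_def)

lemma countable_cylinders:
  assumes "finite V" "V \<subseteq> carrier G" "Z \<subseteq> space \<mu>"
  shows "countable (cylinder V ` Z)"
proof -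
  have "cylinder V ` Z \<subseteq> (\<lambda>v. {y \<in> space \<mu>. restrict y V = v}) ` (\<lambda>x. restrict x V) ` space \<mu>"
    using assms(3) unfolding cylinder_eq_fibre[abs_def] by blast
  moreover have "countable ((\<lambda>x. restrict x V) ` space \<mu>)"
    using discrete_rv_restrict[OF assms(1,2)] by (simp add: discrete_rv_def)
  ultimately show ?thesis by (meson countable_image countable_subset)
qed

lemma sites_algebra_sets:
  assumes "I \<subseteq> carrier G"
  shows "space (sites_algebra I) = space \<mu>"
    and "sets (sites_algebra I) = sigma_sets (space \<mu>) (\<Union>f\<in>I. value_at f ` K)"
proof -
  have eq: "(\<Union>f\<in>I. pullback_partition G K f (canonical_partition G K)) = (\<Union>f\<in>I. value_at f ` K)"
    using assms by (intro SUP_cong refl pullback_canonical(2)) auto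
  have sub: "(\<Union>f\<in>I. value_at f ` K) \<subseteq> Pow (configs G K)"
    by (auto simp: value_at_def space_eq)
  show "space (sites_algebra I) = space \<mu>"
    unfolding join_algebra_def eq using sub by (simp add: space_measure_of space_eq)
  show "sets (sites_algebra I) = sigma_sets (space \<mu>) (\<Union>f\<in>I. value_at f ` K)"
    unfolding join_algebra_def eq using sub by (simp add: sets_measure_of space_eq)
qed

lemma subalgebra_sites_algebra:
  assumes "I \<subseteq> carrier G"
  shows "subalgebra \<mu> (sites_algebra I)"
  unfolding subalgebra_def sites_algebra_sets[OF assms]
  using assms by (auto intro!: sets.sigma_sets_subset)

lemma value_at_sites_algebra:
  assumes "I \<subseteq> carrier G" "f \<in> I"
  shows "value_at f k \<in> sets (sites_algebra I)"
proof (cases "k \<in> K")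
  case True
  then show ?thesis
    unfolding sites_algebra_sets[OF assms(1)] using assms(2) by (auto intro: sigma_sets.Basic)
next
  case False
  then have "value_at f k = {}"
    using assms by (auto simp: value_at_def space_eq configs_def)
  then show ?thesis by simp
qed

lemma cylinder_sites_algebra:
  assumes "I \<subseteq> carrier G" "V \<subseteq> I" "finite V"
  shows "cylinder V z \<in> sets (sites_algebra I)"
proof -
  have "cylinder V z = {y \<in> space (sites_algebra I). \<forall>w\<in>V. y \<in> value_at w (z w)}"
    by (auto simp: cylinder_def value_at_def sites_algebra_sets[OF assms(1)])
  also have "\<dots> \<in> sets (sites_algebra I)"
  proof (rule sets.sets_Collect_finite_All[OF _ assms(3)])
    fix w assume "w \<in> V"
    then have "value_at w (z w) \<in> sets (sites_algebra I)"
      using assms by (intro value_at_sites_algebra) auto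
    moreover from sets.sets_into_space[OF this]
    have "{x \<in> space (sites_algebra I). x \<in> value_at w (z w)} = value_at w (z w)" by auto
    ultimately show "{x \<in> space (sites_algebra I). x \<in> value_at w (z w)} \<in> sets (sites_algebra I)" by simp
  qed
  finally show ?thesis .
qed

lemma transition_prob_bounds: "0 \<le> transition_prob u k g x" "transition_prob u k g x \<le> 1"
  if "u \<in> carrier G" "g \<in> carrier G"
  using that cylinder_sets[of "{g}" x]
  by (auto simp: transition_prob_def divide_le_eq_1 zero_less_measure_iff intro!: finite_measure_mono)

lemma transition_prob_measurable:
  assumes "I \<subseteq> carrier G" "g \<in> I"
  shows "transition_prob u k g \<in> borel_measurable (sites_algebra I)"
proof -
  have sp: "space (sites_algebra I) = space \<mu>" by (rule sites_algebra_sets[OF assms(1)])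
  have "(\<lambda>x. x g) ` space \<mu> \<subseteq> K" using assms by (auto simp: space_eq configs_def)
  then have "countable ((\<lambda>x. x g) ` space \<mu>)" using countable_K countable_subset by blast
  then have "discrete_rv (sites_algebra I) (\<lambda>x. x g)"
    using value_at_sites_algebra[OF assms] by (simp add: discrete_rv_def value_at_def sp)
  from discrete_rv_fun_measurable[OF this, of "\<lambda>v. prob (value_at g v \<inter> value_at u k) / prob (value_at g v)"]
  show ?thesis by (simp add: transition_prob_def[abs_def] cylinder_def value_at_def)
qed

lemma transition_prob_on_cylinder:
  assumes "g \<in> V" "x \<in> cylinder V z"
  shows "transition_prob u k g x = transition_prob u k g z"
proof -
  have "cylinder {g} x = cylinder {g} z" using assms by (auto simp: cylinder_def)
  then show ?thesis by (simp add: transition_prob_def)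
qed

lemma product_formula_iff:
  assumes "finite V" "V \<subseteq> carrier G" "g \<in> V" "u \<in> carrier G"
  shows "prob (cylinder V z \<inter> value_at u k) = transition_prob u k g z * prob (cylinder V z) \<longleftrightarrow>
    prob (cylinder V z \<inter> value_at u k) * prob (cylinder {g} z) =
    prob (cylinder V z) * prob (cylinder {g} z \<inter> value_at u k)"
proof (cases "prob (cylinder {g} z) = 0")
  case True
  have "prob (cylinder V z) \<le> prob (cylinder {g} z)"
    using assms by (intro finite_measure_mono cylinder_sets) (auto simp: cylinder_def)
  moreover have "prob (cylinder V z \<inter> value_at u k) \<le> prob (cylinder V z)"
    using assms by (intro finite_measure_mono cylinder_sets) auto
  ultimately have "prob (cylinder V z) = 0" "prob (cylinder V z \<inter> value_at u k) = 0"
    using True by (simp_all add: measure_le_0_iff)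
  then show ?thesis by simp
next
  case False
  then show ?thesis by (auto simp: transition_prob_def field_simps)
qed

text \<open>
  The cylinders over finite sets \<open>V\<close> with \<open>g \<in> V \<subseteq> I\<close> are stable under intersection and
  generate the \<open>\<sigma>\<close>-algebra of the sites in \<open>I\<close>, so it suffices to test a conditional
  expectation on them; the transition probability depends on \<open>X\<^sub>g\<close> only and is therefore
  constant on each of them.
\<close>

lemma cond_prob_eq_transition_prob_iff:
  assumes I: "I \<subseteq> carrier G" and g: "g \<in> I" and u: "u \<in> carrier G"
  shows "(AE x in \<mu>. real_cond_exp \<mu> (sites_algebra I) (indicator (value_at u k)) x = transition_prob u k g x) \<longleftrightarrow>
    (\<forall>V z. finite V \<and> g \<in> V \<and> V \<subseteq> I \<longrightarrow>
      prob (cylinder V z \<inter> value_at u k) * prob (cylinder {g} z) =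
      prob (cylinder V z) * prob (cylinder {g} z \<inter> value_at u k))" (is "?ae \<longleftrightarrow> ?prod")
proof -
  let ?F = "sites_algebra I" and ?q = "transition_prob u k g" and ?E = "value_at u k"
  have gG: "g \<in> carrier G" using I g by auto
  have sub: "subalgebra \<mu> ?F" by (rule subalgebra_sites_algebra[OF I])
  interpret F: finite_measure_subalgebra \<mu> ?F by unfold_locales (rule sub)
  note q01 = transition_prob_bounds[OF u gG]
  have q_meas: "?q \<in> borel_measurable ?F" by (rule transition_prob_measurable[OF I g])
  then have [measurable]: "?q \<in> borel_measurable \<mu>" by (rule measurable_from_subalg[OF sub])
  have [measurable]: "?E \<in> sets \<mu>" using u by (rule value_at_sets)
  have int_q: "integrable \<mu> ?q"
    by (rule integrable_const_bound[where B = 1]) (auto simp: q01)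
  have int_E: "integrable \<mu> (indicator ?E :: _ \<Rightarrow> real)"
    by (simp add: emeasure_eq_measure)
  have set_int_E: "(LINT x:A|\<mu>. indicator ?E x) = prob (A \<inter> ?E)" if "A \<in> sets \<mu>" for A
    using that by (simp add: set_lebesgue_integral_def indicator_inter_arith[symmetric])
  have set_int_q: "(LINT x:cylinder V z|\<mu>. ?q x) = ?q z * prob (cylinder V z)"
    if "finite V" "V \<subseteq> I" "g \<in> V" for V z
  proof -
    have "(LINT x:cylinder V z|\<mu>. ?q x) = (LINT x:cylinder V z|\<mu>. ?q z)"
      unfolding set_lebesgue_integral_def
      by (rule Bochner_Integration.integral_cong) (auto simp: indicator_def transition_prob_on_cylinder[OF that(3)])
    also have "\<dots> = ?q z * prob (cylinder V z)"
      using that I by (simp add: set_lebesgue_integral_def cylinder_sets)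
    finally show ?thesis .
  qed
  have prod_iff: "?prod \<longleftrightarrow> (\<forall>V z. finite V \<and> g \<in> V \<and> V \<subseteq> I \<longrightarrow>
      prob (cylinder V z \<inter> ?E) = ?q z * prob (cylinder V z))"
    using product_formula_iff[OF _ _ _ u] I by (meson order_trans)
  show ?thesis
    unfolding prod_iff
  proof
    assume ae: ?ae
    show "\<forall>V z. finite V \<and> g \<in> V \<and> V \<subseteq> I \<longrightarrow> prob (cylinder V z \<inter> ?E) = ?q z * prob (cylinder V z)"
    proof clarify
      fix V z assume V: "finite V" "g \<in> V" "V \<subseteq> I"
      note A = cylinder_sites_algebra[OF I V(3,1), of z]
      have A': "cylinder V z \<in> sets \<mu>" using A sub by (auto simp: subalgebra_def)
      have "prob (cylinder V z \<inter> ?E) = (LINT x:cylinder V z|\<mu>. indicator ?E x)"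
        using set_int_E[OF A'] by simp
      also have "\<dots> = (LINT x:cylinder V z|\<mu>. real_cond_exp \<mu> ?F (indicator ?E) x)"
        by (rule F.real_cond_exp_intA[OF int_E A])
      also have "\<dots> = (LINT x:cylinder V z|\<mu>. ?q x)"
        using ae A' by (intro set_lebesgue_integral_cong_AE) auto
      also have "\<dots> = ?q z * prob (cylinder V z)" using V by (intro set_int_q)
      finally show "prob (cylinder V z \<inter> ?E) = ?q z * prob (cylinder V z)" .
    qed
  next
    assume prod: "\<forall>V z. finite V \<and> g \<in> V \<and> V \<subseteq> I \<longrightarrow> prob (cylinder V z \<inter> ?E) = ?q z * prob (cylinder V z)"
    \<comment> \<open>Cylinders are centred at configurations, so the empty set is added for stability under intersection.\<close>
    define C where "C = insert {} {cylinder V z |V z. finite V \<and> g \<in> V \<and> V \<subseteq> I \<and> z \<in> space \<mu>}"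
    \<comment> \<open>The claim is that two measures on the algebra of \<open>I\<close> agree; they do so on the generator \<open>C\<close>.\<close>
    define N1 where "N1 = restr_to_subalg (density \<mu> (indicator ?E)) ?F"
    define N2 where "N2 = restr_to_subalg (density \<mu> (\<lambda>x. ennreal (?q x))) ?F"
    have subd: "subalgebra (density \<mu> f) ?F" for f
      using sub by (simp add: subalgebra_def)
    have CF: "C \<subseteq> sets ?F" using cylinder_sites_algebra[OF I] by (auto simp: C_def)
    have "value_at f k' \<in> sigma_sets (space \<mu>) C" if "f \<in> I" for f k'
    proof -
      have "value_at f k' = \<Union>(cylinder {f, g} ` value_at f k')"
        by (auto simp: value_at_def cylinder_def)
      moreover have "countable (cylinder {f, g} ` value_at f k')"
        using I g that by (intro countable_cylinders) (auto simp: value_at_def)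
      moreover have "A \<in> sigma_sets (space \<mu>) C" if "A \<in> cylinder {f, g} ` value_at f k'" for A
        using that \<open>f \<in> I\<close> g by (auto simp: C_def value_at_def intro!: sigma_sets.Basic)
      ultimately show ?thesis using sigma_sets_UNION by metis
    qed
    then have "sets ?F \<subseteq> sigma_sets (space \<mu>) C"
      unfolding sites_algebra_sets[OF I] by (intro sigma_sets_mono) auto
    moreover have "sigma_sets (space \<mu>) C \<subseteq> sets ?F"
      using sets.sigma_sets_subset[OF CF] sites_algebra_sets(1)[OF I] by simp
    ultimately have sets_F: "sets ?F = sigma_sets (space \<mu>) C" by auto
    have em1: "emeasure N1 A = ennreal (LINT x:A|\<mu>. indicator ?E x)" if "A \<in> sets ?F" for A
    proof -
      have A: "A \<in> sets \<mu>" using that sub by (auto simp: subalgebra_def)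
      then have "emeasure N1 A = (\<integral>\<^sup>+x. indicator (A \<inter> ?E) x \<partial>\<mu>)"
        unfolding N1_def using that by (simp add: emeasure_restr_to_subalg[OF subd] emeasure_density
            indicator_inter_arith mult.commute)
      then show ?thesis using A by (simp add: set_int_E emeasure_eq_measure)
    qed
    have em2: "emeasure N2 A = ennreal (LINT x:A|\<mu>. ?q x)" if "A \<in> sets ?F" for A
    proof -
      have A: "A \<in> sets \<mu>" using that sub by (auto simp: subalgebra_def)
      then have "emeasure N2 A = (\<integral>\<^sup>+x. ennreal (indicator A x * ?q x) \<partial>\<mu>)"
        unfolding N2_def using that
        by (simp add: emeasure_restr_to_subalg[OF subd] emeasure_density)
          (intro nn_integral_cong, simp add: indicator_def)
      also have "\<dots> = ennreal (LINT x:A|\<mu>. ?q x)"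
        unfolding set_lebesgue_integral_def real_scaleR_def
        using integrable_mult_indicator[OF A int_q] q01 by (intro nn_integral_eq_integral) auto
      finally show ?thesis .
    qed
    have "N1 = N2"
    proof (rule measure_eqI_generator_eq_countable)
      show "Int_stable C"
      proof (rule Int_stableI)
        fix A B assume "A \<in> C" "B \<in> C"
        show "A \<inter> B \<in> C"
        proof (cases "A \<inter> B = {}")
          case False
          then obtain y where y: "y \<in> A" "y \<in> B" by auto
          with \<open>A \<in> C\<close> \<open>B \<in> C\<close> obtain V z V' z' where
            V: "A = cylinder V z" "finite V" "g \<in> V" "V \<subseteq> I" "B = cylinder V' z'" "finite V'" "V' \<subseteq> I"
            unfolding C_def by blast
          have "A \<inter> B = cylinder (V \<union> V') y" using y unfolding V by (auto simp: cylinder_def)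
          moreover have "y \<in> space \<mu>" using y V by (auto simp: cylinder_def)
          ultimately show ?thesis using V unfolding C_def by blast
        qed (simp add: C_def)
      qed
      show "C \<subseteq> Pow (space \<mu>)" by (auto simp: C_def cylinder_def)
      show "sets N1 = sigma_sets (space \<mu>) C" "sets N2 = sigma_sets (space \<mu>) C"
        by (simp_all add: N1_def N2_def sets_restr_to_subalg[OF subd] sets_F)
      show "emeasure N1 A = emeasure N2 A" if "A \<in> C" for A
      proof -
        have "A \<in> sets ?F" using CF that by auto
        have "A \<in> sets \<mu>" using \<open>A \<in> sets ?F\<close> sub by (auto simp: subalgebra_def)
        have "prob (A \<inter> ?E) = (LINT x:A|\<mu>. ?q x)"
        proof (cases "A = {}")
          case False
          then obtain V z where V: "A = cylinder V z" "finite V" "g \<in> V" "V \<subseteq> I"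
            using \<open>A \<in> C\<close> unfolding C_def by blast
          show ?thesis
            unfolding V(1) set_int_q[OF V(2,4,3)] using prod V by blast
        qed (simp add: set_lebesgue_integral_def)
        then show ?thesis
          unfolding em1[OF \<open>A \<in> sets ?F\<close>] em2[OF \<open>A \<in> sets ?F\<close>] set_int_E[OF \<open>A \<in> sets \<mu>\<close>] by simp
      qed
      show "cylinder {g} ` space \<mu> \<subseteq> C" using g by (auto simp: C_def)
      show "countable (cylinder {g} ` space \<mu>)" using gG by (intro countable_cylinders) auto
      show "\<Union>(cylinder {g} ` space \<mu>) = space \<mu>" by (auto simp: cylinder_def)
      show "emeasure N1 A \<noteq> \<infinity>" if "A \<in> cylinder {g} ` space \<mu>" for A
      proof -
        have "A \<in> sets ?F" using that g cylinder_sites_algebra[OF I, of "{g}"] by auto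
        then show ?thesis by (simp add: em1)
      qed
    qed
    then have eq: "(LINT x:A|\<mu>. indicator ?E x) = (LINT x:A|\<mu>. ?q x)" if "A \<in> sets ?F" for A
    proof -
      have "ennreal (LINT x:A|\<mu>. indicator ?E x) = ennreal (LINT x:A|\<mu>. ?q x)"
        using \<open>N1 = N2\<close> that by (simp add: em1[symmetric] em2[symmetric])
      moreover have "(LINT x:A|\<mu>. indicator ?E x) \<ge> (0::real)" "(LINT x:A|\<mu>. ?q x) \<ge> 0"
        using q01 by (auto simp: set_lebesgue_integral_def intro!: integral_nonneg_AE)
      ultimately show ?thesis by (simp add: ennreal_inj)
    qed
    show ?ae
      by (rule F.real_cond_exp_charact[OF _ int_E int_q q_meas]) (rule eq)
  qed
qed

text \<open>
  The almost everywhere statement gives the product formula for all \<open>k\<close> for which the event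
  on the left has positive probability. For the others the left-hand side is 0, so it is at
  most the right-hand side for every \<open>k\<close>; both sides have the same sum over \<open>k\<close>, hence they
  are equal.
\<close>

lemma product_formula_iff_AE:
  assumes V: "finite V" "V \<subseteq> carrier G" "g \<in> V" and u: "u \<in> carrier G"
  shows "(\<forall>z k. prob (cylinder V z \<inter> value_at u k) * prob (cylinder {g} z) =
      prob (cylinder V z) * prob (cylinder {g} z \<inter> value_at u k)) \<longleftrightarrow>
    (AE x in \<mu>. site_prob V x * site_prob {g, u} x = site_prob (insert u V) x * site_prob {g} x)"
  (is "?prod \<longleftrightarrow> ?ae")
proof -
  have sp: "site_prob V x = prob (cylinder V x)" "site_prob {g} x = prob (cylinder {g} x)"
    "site_prob {g, u} x = prob (cylinder {g} x \<inter> value_at u (x u))"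
    "site_prob (insert u V) x = prob (cylinder V x \<inter> value_at u (x u))" for x
    by (auto simp: site_prob_eq cylinder_def value_at_def intro!: arg_cong[where f = prob])
  show ?thesis
  proof
    assume ?prod
    then show ?ae unfolding sp by (intro AE_I2) metis
  next
    assume ae: ?ae
    have gG: "g \<in> carrier G" using V by auto
    have uX: "discrete_rv \<mu> (\<lambda>x. x u)"
    proof -
      have "(\<lambda>x. x u) ` space \<mu> \<subseteq> K" using u by (auto simp: space_eq configs_def)
      then show ?thesis
        using countable_K coordinate_measurable[OF u] unfolding discrete_rv_def by (auto intro: countable_subset)
    qed
    have total: "(\<integral>\<^sup>+k. ennreal (prob (cylinder W z \<inter> value_at u k)) \<partial>count_space UNIV) = ennreal (prob (cylinder W z))"
      if "finite W" "W \<subseteq> carrier G" for W z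
    proof -
      have "{x \<in> space \<mu>. x u = k \<and> restrict x W = restrict z W} = cylinder W z \<inter> value_at u k" for k
        by (auto simp: cylinder_eq_fibre value_at_def)
      then show ?thesis
        using sum_emeasure_fibres[OF uX discrete_rv_restrict[OF that], of "restrict z W"]
        by (simp add: emeasure_eq_measure cylinder_eq_fibre)
    qed
    show ?prod
    proof (intro allI)
      fix z k
      let ?b = "\<lambda>k. prob (cylinder V z \<inter> value_at u k) * prob (cylinder {g} z)"
      let ?a = "\<lambda>k. prob (cylinder V z) * prob (cylinder {g} z \<inter> value_at u k)"
      have le: "?b k \<le> ?a k" for k
      proof (cases "prob (cylinder V z \<inter> value_at u k) = 0")
        case False
        have "\<exists>x\<in>cylinder V z \<inter> value_at u k.
          site_prob V x * site_prob {g, u} x = site_prob (insert u V) x * site_prob {g} x"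
        proof (rule ccontr)
          assume no: "\<not> ?thesis"
          have "AE x in \<mu>. x \<notin> cylinder V z \<inter> value_at u k"
            using ae by eventually_elim (use no in blast)
          moreover have "cylinder V z \<inter> value_at u k \<in> sets \<mu>"
            using V u by (intro sets.Int cylinder_sets value_at_sets)
          ultimately have "prob (cylinder V z \<inter> value_at u k) = 0"
            by (simp add: prob_eq_0)
          with False show False by simp
        qed
        then obtain x where x: "x \<in> cylinder V z" "x u = k"
          and eq: "site_prob V x * site_prob {g, u} x = site_prob (insert u V) x * site_prob {g} x"
          by (auto simp: value_at_def)
        have "cylinder V x = cylinder V z" "cylinder {g} x = cylinder {g} z"
          using x(1) V(3) by (auto simp: cylinder_def)
        then show ?thesis using eq x(2) unfolding sp by simp
      qed simp
      have a: "(\<integral>\<^sup>+k. ennreal (?a k) \<partial>count_space UNIV) = ennreal (prob (cylinder V z) * prob (cylinder {g} z))"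
        using total[of "{g}" z] gG by (simp add: ennreal_mult nn_integral_cmult)
      have b: "(\<integral>\<^sup>+k. ennreal (?b k) \<partial>count_space UNIV) = ennreal (prob (cylinder V z) * prob (cylinder {g} z))"
        using total[OF V(1,2), of z] by (simp add: ennreal_mult nn_integral_multc)
      have "(\<integral>\<^sup>+k. ennreal (?a k) - ennreal (?b k) \<partial>count_space UNIV) = 0"
        using a b le by (subst nn_integral_diff) (auto intro!: ennreal_leI)
      then have "ennreal (?a k) - ennreal (?b k) = 0"
        by (simp add: nn_integral_0_iff_AE AE_count_space)
      then have "?a k - ?b k \<le> 0"
        by (simp add: ennreal_minus ennreal_eq_0_iff)
      then show "?b k = ?a k" using le[of k] by simp
    qed
  qed
qed

lemma Past_subset: "Past G S a b \<subseteq> carrier G"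
  by (auto simp: Past_def)

lemma self_in_Past: "g \<in> carrier G \<Longrightarrow> g \<in> Past G S a g"
  by (auto simp: Past_def left_cayley_path_def)

text \<open>
  Taking the past to be \<open>{g}\<close> in \<open>cond_prob_eq_transition_prob_iff\<close> identifies the
  right-hand side of the Markov condition with the transition probability; for the true
  past, the criterion is the equality case of submodularity for \<open>V\<close> and \<open>{g, tg}\<close> over
  \<open>{g}\<close>.
\<close>

lemma Markov_iff_site_entropy:
  assumes S: "S \<subseteq> carrier G"
  shows "Markov G K S \<mu> (canonical_partition G K) \<longleftrightarrow>
    (\<forall>t\<in>S. \<forall>g\<in>carrier G. \<forall>V. finite V \<and> g \<in> V \<and> V \<subseteq> Past G S (t \<otimes>\<^bsub>G\<^esub> g) g \<longrightarrow>
      site_entropy (insert (t \<otimes>\<^bsub>G\<^esub> g) V) + site_entropy {g} =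
      site_entropy V + site_entropy {g, t \<otimes>\<^bsub>G\<^esub> g})"
proof -
  have "(\<forall>A\<in>canonical_partition G K. AE x in \<mu>.
          real_cond_exp \<mu> (sites_algebra (Past G S u g)) (indicator (act_preimage G K u A)) x =
          real_cond_exp \<mu> (sites_algebra {g}) (indicator (act_preimage G K u A)) x) \<longleftrightarrow>
      (\<forall>V. finite V \<and> g \<in> V \<and> V \<subseteq> Past G S u g \<longrightarrow>
        site_entropy (insert u V) + site_entropy {g} = site_entropy V + site_entropy {g, u})"
    (is "?cond \<longleftrightarrow> ?ent") if u: "u \<in> carrier G" and g: "g \<in> carrier G" for u g
  proof -
    let ?I = "Past G S u g"
    have single: "AE x in \<mu>. real_cond_exp \<mu> (sites_algebra {g}) (indicator (value_at u k)) x =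
        transition_prob u k g x" for k
    proof (subst cond_prob_eq_transition_prob_iff)
      show "\<forall>V z. finite V \<and> g \<in> V \<and> V \<subseteq> {g} \<longrightarrow>
        prob (cylinder V z \<inter> value_at u k) * prob (cylinder {g} z) =
        prob (cylinder V z) * prob (cylinder {g} z \<inter> value_at u k)"
      proof clarify
        fix V z assume "g \<in> V" "V \<subseteq> {g}"
        then have "V = {g}" by auto
        then show "prob (cylinder V z \<inter> value_at u k) * prob (cylinder {g} z) =
          prob (cylinder V z) * prob (cylinder {g} z \<inter> value_at u k)" by simp
      qed
    qed (use g u in auto)
    have "?cond \<longleftrightarrow> (\<forall>k\<in>K. AE x in \<mu>.
        real_cond_exp \<mu> (sites_algebra ?I) (indicator (value_at u k)) x =
        real_cond_exp \<mu> (sites_algebra {g}) (indicator (value_at u k)) x)"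
      by (simp add: canonical_partition_def pullback_canonical(1)[OF u])
    also have "\<dots> \<longleftrightarrow> (\<forall>k\<in>K. AE x in \<mu>.
        real_cond_exp \<mu> (sites_algebra ?I) (indicator (value_at u k)) x = transition_prob u k g x)"
    proof (intro ball_cong refl)
      fix k
      show "(AE x in \<mu>. real_cond_exp \<mu> (sites_algebra ?I) (indicator (value_at u k)) x =
          real_cond_exp \<mu> (sites_algebra {g}) (indicator (value_at u k)) x) \<longleftrightarrow>
        (AE x in \<mu>. real_cond_exp \<mu> (sites_algebra ?I) (indicator (value_at u k)) x = transition_prob u k g x)"
        using single[of k] by (auto elim!: AE_mp intro: AE_I2)
    qed
    also have "\<dots> \<longleftrightarrow> (\<forall>k\<in>K. \<forall>V z. finite V \<and> g \<in> V \<and> V \<subseteq> ?I \<longrightarrow>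
        prob (cylinder V z \<inter> value_at u k) * prob (cylinder {g} z) =
        prob (cylinder V z) * prob (cylinder {g} z \<inter> value_at u k))"
      by (simp add: cond_prob_eq_transition_prob_iff[OF Past_subset self_in_Past[OF g] u])
    also have "\<dots> \<longleftrightarrow> (\<forall>V. finite V \<and> g \<in> V \<and> V \<subseteq> ?I \<longrightarrow> (\<forall>z k.
        prob (cylinder V z \<inter> value_at u k) * prob (cylinder {g} z) =
        prob (cylinder V z) * prob (cylinder {g} z \<inter> value_at u k)))"
    proof -
      have "value_at u k = {}" if "k \<notin> K" for k
        using that u by (auto simp: value_at_def space_eq configs_def)
      then have "prob (cylinder V z \<inter> value_at u k) * prob (cylinder {g} z) =
        prob (cylinder V z) * prob (cylinder {g} z \<inter> value_at u k)" if "k \<notin> K" for V z k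
        using that by simp
      then show ?thesis by blast
    qed
    also have "\<dots> \<longleftrightarrow> ?ent"
    proof (intro all_cong1 imp_cong refl)
      fix V assume V: "finite V \<and> g \<in> V \<and> V \<subseteq> ?I"
      then have V': "finite V" "V \<subseteq> carrier G" "g \<in> V" using Past_subset[of S u g] by auto
      have un: "insert g (insert u V) = insert u V" using V by auto
      show "(\<forall>z k. prob (cylinder V z \<inter> value_at u k) * prob (cylinder {g} z) =
          prob (cylinder V z) * prob (cylinder {g} z \<inter> value_at u k)) \<longleftrightarrow>
        site_entropy (insert u V) + site_entropy {g} = site_entropy V + site_entropy {g, u}"
        using product_formula_iff_AE[OF V' u] site_entropy_modular_iff[of V "{g, u}" "{g}"] V' u g
        by (simp add: un)
    qed
    finally show ?thesis .
  qed
  then show ?thesis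
    using S G.m_closed unfolding Markov_def by (meson subsetD)
qed

end

section \<open>Reduced words and the left Cayley graph\<close>

abbreviation cancels :: "nat \<times> bool \<Rightarrow> nat \<times> bool \<Rightarrow> bool" where
  "cancels a b \<equiv> fst a = fst b \<and> snd a \<noteq> snd b"

lemma reduced_word_simps [simp]:
  "reduced_word []" "reduced_word [a]"
  "reduced_word (a # b # w) \<longleftrightarrow> \<not> cancels a b \<and> reduced_word (b # w)"
  by (auto simp: reduced_word_def)

lemma reduced_word_Cons: "reduced_word (a # w) \<longleftrightarrow> (w = [] \<or> \<not> cancels a (hd w)) \<and> reduced_word w"
  by (cases w) auto

lemma reduced_word_append:
  "reduced_word (u @ v) \<longleftrightarrow> reduced_word u \<and> reduced_word v \<and> (u \<noteq> [] \<longrightarrow> v \<noteq> [] \<longrightarrow> \<not> cancels (last u) (hd v))"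
  by (auto simp: reduced_word_def successively_append_iff)

lemma positive_word_reduced: "set w \<subseteq> A \<times> {True} \<Longrightarrow> reduced_word w"
  by (induction w rule: induct_list012) auto

text \<open>
  Groups and semigroups are treated together: elements are reduced words in the letters
  \<open>(i, b)\<close> with \<open>b \<in> signs\<close>. For a semigroup only the positive sign occurs and every word is
  reduced.
\<close>

locale free_words =
  fixes G :: "('g, 'm) monoid_scheme" and s :: "nat \<Rightarrow> 'g" and r :: nat and signs :: "bool set"
  assumes monoid_G: "monoid G"
    and generators: "s ` {1..r} \<subseteq> carrier G"
    and signs_cases: "signs = {True} \<or> signs = UNIV \<and> group G"
    and normal_form: "bij_betw (\<lambda>w. word_product G (map (letter_value G s) w))
       {w. set w \<subseteq> {1..r} \<times> signs \<and> reduced_word w} (carrier G)"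
begin

interpretation G: monoid G by (rule monoid_G)

definition letters :: "(nat \<times> bool) set" where "letters = {1..r} \<times> signs"

definition words :: "(nat \<times> bool) list set" where
  "words = {w. set w \<subseteq> letters \<and> reduced_word w}"

definition eval_word :: "(nat \<times> bool) list \<Rightarrow> 'g" where
  "eval_word w = word_product G (map (letter_value G s) w)"

abbreviation letter :: "nat \<times> bool \<Rightarrow> 'g" where "letter \<equiv> letter_value G s"

definition short_words :: "nat \<Rightarrow> (nat \<times> bool) list set" where
  "short_words n = {w \<in> words. length w \<le> n}"

definition layer :: "nat \<Rightarrow> (nat \<times> bool) list set" where
  "layer n = {w \<in> words. length w = n}"

lemma True_in_signs: "True \<in> signs" using signs_cases by auto

lemma letter_closed:
  assumes "a \<in> letters"
  shows "letter a \<in> carrier G"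
proof (cases a)
  case (Pair i b)
  have "s i \<in> carrier G" using assms generators Pair by (auto simp: letters_def)
  moreover have "group G" if "\<not> b" using assms signs_cases that Pair by (auto simp: letters_def)
  ultimately show ?thesis using Pair by (auto intro: group.inv_closed)
qed

lemma eval_word_simps:
  "eval_word [] = \<one>\<^bsub>G\<^esub>"
  "eval_word (a # w) = letter a \<otimes>\<^bsub>G\<^esub> eval_word w"
  by (simp_all add: eval_word_def word_product_def)

lemma eval_word_closed: "set w \<subseteq> letters \<Longrightarrow> eval_word w \<in> carrier G"
  by (induction w) (auto simp: eval_word_simps letter_closed)

lemma eval_word_append:
  "set u \<subseteq> letters \<Longrightarrow> set v \<subseteq> letters \<Longrightarrow> eval_word (u @ v) = eval_word u \<otimes>\<^bsub>G\<^esub> eval_word v"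
  by (induction u) (auto simp: eval_word_simps letter_closed eval_word_closed G.m_assoc)

lemma eval_words_bij: "bij_betw eval_word words (carrier G)"
  using normal_form by (simp add: words_def letters_def eval_word_def[abs_def])

lemma eval_words_inj: "inj_on eval_word words"
  using eval_words_bij by (rule bij_betw_imp_inj_on)

lemma eval_words_eq_iff: "u \<in> words \<Longrightarrow> v \<in> words \<Longrightarrow> eval_word u = eval_word v \<longleftrightarrow> u = v"
  using eval_words_inj by (auto dest: inj_onD)

lemma obtain_word:
  assumes "g \<in> carrier G"
  obtains w where "w \<in> words" "g = eval_word w"
  using assms eval_words_bij by (auto simp: bij_betw_def)

lemma words_closed: "w \<in> words \<Longrightarrow> eval_word w \<in> carrier G"
  by (auto simp: words_def intro: eval_word_closed)

lemma words_Cons: "a # w \<in> words \<Longrightarrow> a \<in> letters \<and> w \<in> words"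
  by (auto simp: words_def reduced_word_Cons)

lemma words_tl: "w \<in> words \<Longrightarrow> tl w \<in> words"
  by (cases w) (auto dest: words_Cons)

lemma words_butlast: "w \<in> words \<Longrightarrow> butlast w \<in> words"
  by (cases w rule: rev_cases) (auto simp: words_def reduced_word_append)

lemma Nil_in_words [simp]: "[] \<in> words" by (simp add: words_def)

lemma letter_cancel:
  assumes "a \<in> letters" "b \<in> letters" "cancels a b"
  shows "letter a \<otimes>\<^bsub>G\<^esub> letter b = \<one>\<^bsub>G\<^esub>"
proof -
  have "signs \<noteq> {True}" using assms by (auto simp: letters_def)
  then interpret group G using signs_cases by auto
  have "s (fst a) \<in> carrier G" using assms generators by (auto simp: letters_def)
  then show ?thesis using assms(3) by (cases a; cases b) auto
qed

lemma left_multiply_cases: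
  assumes "a \<in> letters" "v \<in> words"
  obtains "a # v \<in> words" "letter a \<otimes>\<^bsub>G\<^esub> eval_word v = eval_word (a # v)"
  | b v' where "v = b # v'" "letter a \<otimes>\<^bsub>G\<^esub> eval_word v = eval_word v'"
proof (cases "a # v \<in> words")
  case True
  then show ?thesis using that(1) by (simp add: eval_word_simps)
next
  case False
  then have "v \<noteq> []" "cancels a (hd v)"
    using assms by (auto simp: words_def reduced_word_Cons)
  then obtain b v' where v: "v = b # v'" "cancels a b" by (cases v) auto
  then have b: "b \<in> letters" "v' \<in> words" using assms(2) words_Cons by auto
  have "letter a \<otimes>\<^bsub>G\<^esub> eval_word v = (letter a \<otimes>\<^bsub>G\<^esub> letter b) \<otimes>\<^bsub>G\<^esub> eval_word v'"
    using v b assms by (simp add: eval_word_simps G.m_assoc letter_closed words_closed)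
  also have "\<dots> = eval_word v'"
    using letter_cancel[OF assms(1) b(1) v(2)] b by (simp add: words_closed)
  finally show ?thesis using that(2) v(1) by blast
qed

lemma reduce_word:
  "set ws \<subseteq> letters \<Longrightarrow> \<exists>w\<in>words. eval_word w = eval_word ws \<and> length w \<le> length ws"
proof (induction ws)
  case (Cons a ws)
  then obtain v where v: "v \<in> words" "eval_word v = eval_word ws" "length v \<le> length ws" by auto
  have a: "a \<in> letters" using Cons by auto
  show ?case
  proof (cases rule: left_multiply_cases[OF a v(1)])
    case 1
    then show ?thesis using v by (intro bexI[of _ "a # v"]) (simp_all add: eval_word_simps)
  next
    case (2 b v')
    then show ?thesis
      using v words_Cons[of b v'] by (intro bexI[of _ v']) (auto simp: eval_word_simps)
  qed
qed (auto intro!: bexI[of _ "[]"])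

lemma word_length_eval:
  assumes "w \<in> words"
  shows "word_length G (letter ` letters) (eval_word w) = length w"
  unfolding word_length_def
proof (rule Least_equality)
  show "\<exists>ws\<in>lists (letter ` letters). length ws = length w \<and> word_product G ws = eval_word w"
    using assms by (intro bexI[of _ "map letter w"])
      (auto simp: eval_word_def words_def lists_image simp del: letter_value.simps)
next
  fix n assume "\<exists>ws\<in>lists (letter ` letters). length ws = n \<and> word_product G ws = eval_word w"
  then obtain vs where vs: "set vs \<subseteq> letters" "length vs = n" "eval_word vs = eval_word w"
    unfolding lists_image eval_word_def by auto
  from reduce_word[OF vs(1)] obtain v where "v \<in> words" "eval_word v = eval_word vs" "length v \<le> n"
    using vs by auto
  then show "length w \<le> n" using vs assms eval_words_eq_iff by auto
qed

lemma word_ball_eq: "word_ball G (letter ` letters) n = eval_word ` short_words n"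
proof (intro subset_antisym subsetI)
    fix g
    assume "g \<in> word_ball G (letter ` letters) n"
    then show "g \<in> eval_word ` short_words n"
      by (auto simp: word_ball_def short_words_def word_length_eval elim!: obtain_word)
  next
    fix g
    assume "g \<in> eval_word ` short_words n"
    then show "g \<in> word_ball G (letter ` letters) n"
      by (auto simp: word_ball_def short_words_def word_length_eval words_closed)
qed

lemma finite_letters: "finite letters"
  by (simp add: letters_def finite_cartesian_product)

lemma finite_short_words: "finite (short_words n)"
  by (rule finite_subset[OF _ finite_lists_length_le[OF finite_letters, of n]])
    (auto simp: short_words_def words_def)

lemma finite_layer: "finite (layer n)"
  by (rule finite_subset[OF _ finite_short_words[of n]]) (auto simp: layer_def short_words_def)

lemma short_words_0: "short_words 0 = {[]}"
  by (auto simp: short_words_def)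

lemma short_words_Suc: "short_words (Suc n) = short_words n \<union> layer (Suc n)"
  by (auto simp: short_words_def layer_def)

lemma short_words_layer_disjoint: "short_words n \<inter> layer (Suc n) = {}"
  by (auto simp: short_words_def layer_def)

lemma right_multiply_short_words:
  assumes "a \<in> letters" "w \<in> short_words n"
  shows "eval_word w \<otimes>\<^bsub>G\<^esub> letter a \<in> eval_word ` short_words (Suc n)"
proof -
  have w: "set w \<subseteq> letters" "length w \<le> n" using assms by (auto simp: short_words_def words_def)
  have "eval_word w \<otimes>\<^bsub>G\<^esub> letter a = eval_word (w @ [a])"
    using w assms by (simp add: eval_word_append eval_word_simps letter_closed)
  moreover obtain v where "v \<in> words" "eval_word v = eval_word (w @ [a])" "length v \<le> Suc n"
    using reduce_word[of "w @ [a]"] w assms by auto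
  ultimately show ?thesis by (auto simp: short_words_def intro!: image_eqI[of _ _ v])
qed

text \<open>
  Right multiplication by \<open>s\<^sub>i\<close> either appends the letter or cancels the last one, and only
  appending to a word of length \<open>n\<close> leaves the ball.
\<close>

lemma ball_Un_right_translate:
  assumes i: "i \<in> {1..r}"
  shows "eval_word ` short_words n \<union> (\<lambda>x. x \<otimes>\<^bsub>G\<^esub> s i) ` eval_word ` short_words n =
    eval_word ` (short_words n \<union> {u \<in> layer (Suc n). last u = (i, True)})" (is "?l = ?r")
proof
  have a: "(i, True) \<in> letters" using i True_in_signs by (simp add: letters_def)
  have snoc: "eval_word w \<otimes>\<^bsub>G\<^esub> s i = eval_word (w @ [(i, True)])" if "set w \<subseteq> letters" for w
    using that a letter_closed[OF a] by (simp add: eval_word_append eval_word_simps)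
  have "eval_word w \<otimes>\<^bsub>G\<^esub> s i \<in> ?r" if w: "w \<in> short_words n" for w
  proof (cases "w @ [(i, True)] \<in> words")
    case True
    then have "w @ [(i, True)] \<in> short_words n \<union> {u \<in> layer (Suc n). last u = (i, True)}"
      using w by (auto simp: short_words_def layer_def)
    then show ?thesis using w by (subst snoc) (auto simp: short_words_def words_def)
  next
    case False
    then have "w \<noteq> []" "cancels (last w) (i, True)"
      using w a by (auto simp: short_words_def words_def reduced_word_append)
    then obtain v b where v: "w = v @ [b]" "cancels b (i, True)" by (cases w rule: rev_cases) auto
    have v': "v \<in> short_words n" "b \<in> letters"
      using w v words_butlast[of w] by (auto simp: short_words_def words_def)
    then have "eval_word w \<otimes>\<^bsub>G\<^esub> s i = eval_word v \<otimes>\<^bsub>G\<^esub> (letter b \<otimes>\<^bsub>G\<^esub> letter (i, True))"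
      using v letter_closed[OF a] letter_closed[of b] words_closed[of v]
      by (simp add: eval_word_append eval_word_simps short_words_def words_def G.m_assoc)
    also have "\<dots> = eval_word v"
      using letter_cancel[OF v'(2) a v(2)] v' by (simp add: words_closed short_words_def)
    finally show ?thesis using v' by auto
  qed
  then show "?l \<subseteq> ?r" by auto
  have "eval_word u \<in> ?l" if "u \<in> layer (Suc n)" "last u = (i, True)" for u
  proof -
    have u: "u = butlast u @ [(i, True)]" using that by (cases u rule: rev_cases) (auto simp: layer_def)
    have "butlast u \<in> short_words n"
      using that words_butlast[of u] by (auto simp: layer_def short_words_def)
    then show ?thesis using snoc[of "butlast u"] u by (force simp: short_words_def words_def)
  qed
  then show "?r \<subseteq> ?l" by auto
qed

text \<open>
  Left multiplication by a letter adds or removes the first letter, so the left Cayley graph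
  is the tree of reduced words in which the parent of a word is its tail.
\<close>

lemma left_cayley_neighbours:
  assumes x: "v \<in> words" "x = eval_word v"
    and adj: "(x, y) \<in> left_cayley_edges G (letter ` letters) \<or> (y, x) \<in> left_cayley_edges G (letter ` letters)"
  obtains v' a where "v' \<in> words" "y = eval_word v'" "v' = a # v \<or> v = a # v'"
proof -
  have step: "\<exists>v' a. v' \<in> words \<and> y = eval_word v' \<and> (v' = a # v \<or> v = a # v')"
    if "v \<in> words" "(eval_word v, y) \<in> left_cayley_edges G (letter ` letters)" for v y
  proof -
    from that obtain a where a: "a \<in> letters" "y = letter a \<otimes>\<^bsub>G\<^esub> eval_word v"
      by (auto simp: left_cayley_edges_def)
    show ?thesis
      using a(1) that(1)
    proof (cases rule: left_multiply_cases)
      case 1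
      then show ?thesis using a by metis
    next
      case (2 b v')
      then show ?thesis using a that words_Cons[of b v'] by metis
    qed
  qed
  from adj show ?thesis
  proof
    assume "(x, y) \<in> left_cayley_edges G (letter ` letters)"
    then show ?thesis using step[of v y] x that by blast
  next
    assume e: "(y, x) \<in> left_cayley_edges G (letter ` letters)"
    then have "y \<in> carrier G" by (auto simp: left_cayley_edges_def)
    then obtain v' where v': "v' \<in> words" "y = eval_word v'" by (rule obtain_word)
    then obtain v'' a where "v'' \<in> words" "x = eval_word v''" "v'' = a # v' \<or> v' = a # v''"
      using step[of v' x] e by blast
    moreover from this have "v'' = v" using x eval_words_eq_iff by blast
    ultimately show ?thesis using v' that by blast
  qed
qed

text \<open>
  The words with suffix \<open>t # w\<close> form the branch of the tree above \<open>t # w\<close>; a path that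
  starts outside of it enters it through its root, coming from the parent \<open>w\<close>.
\<close>

lemma in_PastI:
  assumes tw: "t # w \<in> words" and v: "v \<in> words" "\<not> suffix (t # w) v"
  shows "eval_word v \<in> Past G (letter ` letters) (eval_word (t # w)) (eval_word w)"
proof -
  have "eval_word w \<in> set p"
    if "left_cayley_path G (letter ` letters) p" "hd p = eval_word v" "last p = eval_word (t # w)"
      "v \<in> words" "\<not> suffix (t # w) v" for p v
    using that
  proof (induction p arbitrary: v rule: induct_list012)
    case 1
    then show ?case by (simp add: left_cayley_path_def)
  next
    case (2 x)
    then show ?case using tw eval_words_eq_iff by auto
  next
    case (3 x y zs)
    have path: "left_cayley_path G (letter ` letters) (y # zs)"
      and adj: "(x, y) \<in> left_cayley_edges G (letter ` letters) \<or> (y, x) \<in> left_cayley_edges G (letter ` letters)"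
      using 3(3) by (auto simp: left_cayley_path_def)
    have x: "x = eval_word v" using 3(4) by simp
    obtain v' a where v': "v' \<in> words" "y = eval_word v'" "v' = a # v \<or> v = a # v'"
      using left_cayley_neighbours[OF 3(6) x adj] .
    show ?case
    proof (cases "suffix (t # w) v'")
      case True
      then have "w = v" using v'(3) 3(7) by (auto simp: suffix_Cons)
      then show ?thesis using x by simp
    next
      case False
      then show ?thesis using 3(2)[of v'] path v' 3(5) by simp
    qed
  qed
  then show ?thesis
    using v words_closed by (auto simp: Past_def)
qed

text \<open>
  Deleting the letters of \<open>v\<close> one by one leads to \<open>tg\<close>. This path never meets \<open>g\<close>, because
  no nonempty reduced word fixes \<open>g\<close> by left multiplication.
\<close>

lemma not_in_Past:
  assumes "v @ [t] \<in> words" "g \<in> carrier G"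
  shows "eval_word (v @ [t]) \<otimes>\<^bsub>G\<^esub> g \<notin> Past G (letter ` letters) (letter t \<otimes>\<^bsub>G\<^esub> g) g"
proof -
  have no_fix: "eval_word (v @ [t]) \<otimes>\<^bsub>G\<^esub> g \<noteq> g" if "v @ [t] \<in> words" for v
  proof (cases "signs = {True}")
    case True
    obtain w where w: "w \<in> words" "g = eval_word w" using obtain_word[OF assms(2)] .
    \<comment> \<open>Substituting by hand, as the simplifier would also rewrite the locale parameter inside \<open>letters\<close>.\<close>
    have letters_eq: "letters = {1..r} \<times> {True}"
      by (subst letters_def, subst True, rule refl)
    have red: "set u \<subseteq> letters \<Longrightarrow> reduced_word u" for u
      unfolding letters_eq by (rule positive_word_reduced)
    have vt: "set (v @ [t]) \<subseteq> letters" and w': "set w \<subseteq> letters"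
      using that w(1) unfolding words_def by blast+
    then have "v @ [t] @ w \<in> words" using red[of "v @ [t] @ w"] unfolding words_def by simp
    then have "eval_word (v @ [t] @ w) \<noteq> eval_word w"
      using eval_words_eq_iff[OF _ w(1)] by auto
    then show ?thesis
      unfolding w(2) using eval_word_append[OF vt w'] by simp
  next
    case False
    then interpret group G using signs_cases by auto
    show ?thesis
    proof
      assume "eval_word (v @ [t]) \<otimes>\<^bsub>G\<^esub> g = g"
      then have "eval_word (v @ [t]) = eval_word []"
        using assms(2) words_closed[OF that] by (simp add: eval_word_simps r_cancel_one)
      then show False using that eval_words_eq_iff[of "v @ [t]" "[]"] by simp
    qed
  qed
  have "\<exists>p. left_cayley_path G (letter ` letters) p \<and> hd p = eval_word (v @ [t]) \<otimes>\<^bsub>G\<^esub> g \<and>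
      last p = letter t \<otimes>\<^bsub>G\<^esub> g \<and> g \<notin> set p"
    using assms(1)
  proof (induction v)
    case Nil
    have "t \<in> letters" using Nil by (simp add: words_def)
    then show ?case
      using no_fix[of "[]"] Nil assms(2)
      by (intro exI[of _ "[letter t \<otimes>\<^bsub>G\<^esub> g]"]) (auto simp: left_cayley_path_def eval_word_simps letter_closed)
  next
    case (Cons a v)
    have v: "a \<in> letters" "v @ [t] \<in> words" using Cons.prems words_Cons[of a "v @ [t]"] by auto
    obtain p where p: "left_cayley_path G (letter ` letters) p" "hd p = eval_word (v @ [t]) \<otimes>\<^bsub>G\<^esub> g"
      "last p = letter t \<otimes>\<^bsub>G\<^esub> g" "g \<notin> set p"
      using Cons.IH v by blast
    let ?x = "eval_word ((a # v) @ [t]) \<otimes>\<^bsub>G\<^esub> g"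
    have x: "?x = letter a \<otimes>\<^bsub>G\<^esub> hd p"
      using v assms(2) by (simp add: p(2) eval_word_simps letter_closed words_closed G.m_assoc)
    have hd: "hd p \<in> carrier G" using p(2) v assms(2) words_closed by simp
    then have "(hd p, ?x) \<in> left_cayley_edges G (letter ` letters)"
      using v x by (auto simp: left_cayley_edges_def)
    moreover have "?x \<in> carrier G" using x hd v letter_closed by simp
    ultimately have "left_cayley_path G (letter ` letters) (?x # p)"
      using p(1) by (cases p) (auto simp: left_cayley_path_def)
    moreover have "last (?x # p) = letter t \<otimes>\<^bsub>G\<^esub> g" using p(1,3) by (auto simp: left_cayley_path_def)
    moreover have "g \<notin> set (?x # p)" using p(4) no_fix[OF Cons.prems] by auto
    ultimately show ?case by (intro exI[of _ "?x # p"]) simp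
  qed
  then show ?thesis unfolding Past_def by blast
qed

end

section \<open>Invariant submodular functions on the Cayley tree\<close>

lemma (in free_words) Nil_short_words [simp]: "[] \<in> short_words n"
  by (simp add: short_words_def)

lemma (in free_words) generator_closed: "i \<in> {1..r} \<Longrightarrow> s i \<in> carrier G"
  using generators by auto

text \<open>
  The subtrees containing the root are the nonempty sets of words closed under tails; the
  convention \<open>tl [] = []\<close> makes the root harmless.
\<close>

definition tail_closed :: "'a list set \<Rightarrow> bool" where
  "tail_closed W \<longleftrightarrow> (\<forall>w\<in>W. tl w \<in> W)"

locale stationary_set_function = free_words +
  fixes h :: "'a set \<Rightarrow> real"
  assumes submodular: "\<And>A B C. finite A \<Longrightarrow> finite B \<Longrightarrow> A \<subseteq> carrier G \<Longrightarrow> B \<subseteq> carrier G \<Longrightarrow>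
      C \<subseteq> A \<inter> B \<Longrightarrow> h (A \<union> B) + h C \<le> h A + h B"
    and translation: "\<And>W g. finite W \<Longrightarrow> W \<subseteq> carrier G \<Longrightarrow> g \<in> carrier G \<Longrightarrow>
      h ((\<lambda>w. w \<otimes>\<^bsub>G\<^esub> g) ` W) = h W"
begin

interpretation G: monoid G by (rule monoid_G)

text \<open>
  One formula serves both signs, since \<open>{e, s\<^sub>i}\<close> is a translate of \<open>{e, s\<^sub>i\<inverse>}\<close>.
\<close>

definition edge_gain :: "nat \<times> bool \<Rightarrow> real" where
  "edge_gain a = h {\<one>\<^bsub>G\<^esub>, s (fst a)} - h {\<one>\<^bsub>G\<^esub>}"

text \<open>
  Each nonempty word stands for the edge joining it to its tail.
\<close>

definition tree_value :: "(nat \<times> bool) list set \<Rightarrow> real" where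
  "tree_value W = h {\<one>\<^bsub>G\<^esub>} + (\<Sum>w\<in>W - {[]}. edge_gain (hd w))"

definition ball_value :: "nat \<Rightarrow> real" where
  "ball_value n = h (eval_word ` short_words n)"

text \<open>
  For \<open>h\<close> the entropy, this is the value of \<open>F\<close> at the partition \<open>\<alpha>\<^sup>n\<close>.
\<close>

definition F_on_ball :: "nat \<Rightarrow> real" where
  "F_on_ball n = (1 - 2 * real r) * ball_value n +
    (\<Sum>i = 1..r. h (eval_word ` short_words n \<union> (\<lambda>x. x \<otimes>\<^bsub>G\<^esub> s i) ` eval_word ` short_words n))"

text \<open>
  The layer is split by the sign of the last letter because \<open>F_on_ball\<close> only involves
  translates by positive generators; the gain itself depends on the first letter.
\<close>

definition signed_layer_gain :: "bool \<Rightarrow> nat \<Rightarrow> real" where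
  "signed_layer_gain b n = (\<Sum>w\<in>layer n. if snd (last w) = b then edge_gain (hd w) else 0)"

definition markov_function :: bool where
  "markov_function \<longleftrightarrow> (\<forall>t\<in>letter ` letters. \<forall>g\<in>carrier G. \<forall>V.
     finite V \<and> g \<in> V \<and> V \<subseteq> Past G (letter ` letters) (t \<otimes>\<^bsub>G\<^esub> g) g \<longrightarrow>
     h (insert (t \<otimes>\<^bsub>G\<^esub> g) V) + h {g} = h V + h {g, t \<otimes>\<^bsub>G\<^esub> g})"

lemma singleton_value: "g \<in> carrier G \<Longrightarrow> h {g} = h {\<one>\<^bsub>G\<^esub>}"
  using translation[of "{\<one>\<^bsub>G\<^esub>}" g] by simp

lemma edge_value:
  assumes "t \<in> letters" "g \<in> carrier G"
  shows "h {g, letter t \<otimes>\<^bsub>G\<^esub> g} = h {\<one>\<^bsub>G\<^esub>} + edge_gain t"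
proof (cases t)
  case (Pair i b)
  have si: "s i \<in> carrier G" using assms Pair generators by (auto simp: letters_def)
  have base: "h {x, s i \<otimes>\<^bsub>G\<^esub> x} = h {\<one>\<^bsub>G\<^esub>, s i}" if "x \<in> carrier G" for x
    using translation[of "{\<one>\<^bsub>G\<^esub>, s i}" x] that si by simp
  show ?thesis
  proof (cases b)
    case True
    then show ?thesis using base[OF assms(2)] Pair by (simp add: edge_gain_def)
  next
    case False
    then have "group G" using assms(1) signs_cases Pair by (auto simp: letters_def)
    then interpret group G .
    let ?x = "inv\<^bsub>G\<^esub> (s i) \<otimes>\<^bsub>G\<^esub> g"
    have "s i \<otimes>\<^bsub>G\<^esub> ?x = g" using si assms(2) by (simp add: G.m_assoc[symmetric])
    then show ?thesis
      using base[of ?x] si assms(2) Pair False by (simp add: edge_gain_def insert_commute)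
  qed
qed

text \<open>
  Submodularity for \<open>V\<close> and \<open>{g, tg}\<close> over \<open>{g}\<close>.
\<close>

lemma leaf_gain_le:
  assumes "t \<in> letters" "finite V" "V \<subseteq> carrier G" "g \<in> V"
  shows "h (insert (letter t \<otimes>\<^bsub>G\<^esub> g) V) \<le> h V + edge_gain t"
proof -
  have g: "g \<in> carrier G" using assms by auto
  have "V \<union> {g, letter t \<otimes>\<^bsub>G\<^esub> g} = insert (letter t \<otimes>\<^bsub>G\<^esub> g) V" using assms by auto
  then show ?thesis
    using submodular[of V "{g, letter t \<otimes>\<^bsub>G\<^esub> g}" "{g}"] assms g letter_closed[OF assms(1)]
      edge_value[OF assms(1) g] singleton_value[OF g] by simp
qed

lemma eval_image_closed: "W \<subseteq> words \<Longrightarrow> eval_word ` W \<subseteq> carrier G"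
  using words_closed by auto

text \<open>
  The new words are added one at a time, each after its tail.
\<close>

lemma tree_growth_le:
  assumes "finite W'" "W' \<subseteq> words" "tail_closed W'" "tail_closed W" "W \<subseteq> W'" "[] \<in> W"
  shows "h (eval_word ` W') \<le> h (eval_word ` W) + (\<Sum>w\<in>W' - W. edge_gain (hd w))"
  using assms
proof (induction "card (W' - W)" arbitrary: W')
  case 0
  then have "W' = W" by auto
  then show ?case by simp
next
  case (Suc n)
  let ?D = "W' - W"
  have fin: "finite ?D" using Suc by simp
  have ne: "?D \<noteq> {}" using Suc(2) by (metis card.empty nat.distinct(1))
  \<comment> \<open>A longest new word is a leaf of \<open>W'\<close>.\<close>
  define u where "u = (ARG_MAX length w. w \<in> ?D)"
  have u: "u \<in> ?D" "\<And>w. w \<in> ?D \<Longrightarrow> length w \<le> length u"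
  proof -
    obtain w where "w \<in> ?D" using ne by auto
    moreover have "\<forall>w. w \<in> ?D \<longrightarrow> length w < Suc (Max (length ` ?D))"
      using fin by (simp add: less_Suc_eq_le)
    ultimately have "u \<in> ?D \<and> (\<forall>w. w \<in> ?D \<longrightarrow> length w \<le> length u)"
      unfolding u_def by (rule arg_max_nat_lemma)
    then show "u \<in> ?D" "\<And>w. w \<in> ?D \<Longrightarrow> length w \<le> length u" by auto
  qed
  have u_ne: "u \<noteq> []" using u(1) Suc.prems by auto
  define V where "V = W' - {u}"
  have V_tl: "tl u \<in> V" using u(1) u_ne Suc.prems(3) by (auto simp: V_def tail_closed_def) (metis length_tl
      diff_less length_greater_0_conv less_irrefl zero_less_one)
  have "tail_closed V"
    unfolding tail_closed_def
  proof
    fix w assume w: "w \<in> V"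
    have "tl w \<noteq> u"
    proof
      assume e: "tl w = u"
      then have "length w > length u" using u_ne by (cases w) auto
      then have "w \<in> W" using u(2)[of w] w by (auto simp: V_def)
      then have "u \<in> W" using e Suc.prems(4) by (auto simp: tail_closed_def)
      then show False using u(1) by simp
    qed
    then show "tl w \<in> V" using w Suc.prems(3) by (auto simp: V_def tail_closed_def)
  qed
  moreover have D: "?D = insert u (V - W)" "u \<notin> V - W" using u(1) by (auto simp: V_def)
  moreover have "n = card (V - W)" using Suc(2) D fin by (metis card_insert_disjoint finite_insert nat.inject)
  moreover have "finite V" "V \<subseteq> words" "W \<subseteq> V" using Suc.prems u(1) by (auto simp: V_def)
  ultimately have IH: "h (eval_word ` V) \<le> h (eval_word ` W) + (\<Sum>w\<in>V - W. edge_gain (hd w))"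
    using Suc(1)[of V] Suc.prems by blast
  have uw: "u \<in> words" "u = hd u # tl u" using u(1) u_ne Suc.prems by auto
  then have "hd u \<in> letters" using words_Cons by metis
  then have "h (insert (letter (hd u) \<otimes>\<^bsub>G\<^esub> eval_word (tl u)) (eval_word ` V)) \<le>
      h (eval_word ` V) + edge_gain (hd u)"
    using V_tl \<open>finite V\<close> eval_image_closed[OF \<open>V \<subseteq> words\<close>] by (intro leaf_gain_le) auto
  moreover have "insert (letter (hd u) \<otimes>\<^bsub>G\<^esub> eval_word (tl u)) (eval_word ` V) = eval_word ` W'"
  proof -
    have "W' = insert u V" using u(1) by (auto simp: V_def)
    moreover have "eval_word u = letter (hd u) \<otimes>\<^bsub>G\<^esub> eval_word (tl u)"
      using uw(2) eval_word_simps(2) by metis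
    ultimately show ?thesis by simp
  qed
  ultimately show ?case
    using IH D fin by simp
qed

lemma tail_closed_short_words: "tail_closed (short_words n)"
  unfolding tail_closed_def
proof
  fix w assume "w \<in> short_words n"
  then show "tl w \<in> short_words n" using words_tl[of w] by (auto simp: short_words_def)
qed

lemma short_words_subset_words: "short_words n \<subseteq> words"
  by (auto simp: short_words_def)

lemma value_le_tree_value:
  assumes "finite W" "W \<subseteq> words" "tail_closed W" "[] \<in> W"
  shows "h (eval_word ` W) \<le> tree_value W"
  using tree_growth_le[OF assms(1-3), of "{[]}"] assms(4)
  by (simp add: tree_value_def tail_closed_def eval_word_simps)

lemma ball_value_le: "ball_value n \<le> tree_value (short_words n)"
  unfolding ball_value_def
  by (intro value_le_tree_value finite_short_words short_words_subset_words tail_closed_short_words) simp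

lemma short_words_subsetE:
  assumes "finite W" "W \<subseteq> words"
  obtains n where "W \<subseteq> short_words n"
proof -
  have "length w \<le> Max (insert 0 (length ` W))" if "w \<in> W" for w
    using assms(1) that by (intro Max_ge) auto
  then show ?thesis using assms(2) that[of "Max (insert 0 (length ` W))"] by (auto simp: short_words_def)
qed

text \<open>
  Growing the subtree \<open>W\<close> to a ball loses nothing in total if the ball attains its tree
  value, so nothing can be lost before \<open>W\<close> is reached.
\<close>

lemma tree_value_exact:
  assumes ball: "\<And>n. ball_value n = tree_value (short_words n)"
    and W: "finite W" "W \<subseteq> words" "tail_closed W" "[] \<in> W"
  shows "h (eval_word ` W) = tree_value W"
proof (rule antisym)
  show "h (eval_word ` W) \<le> tree_value W" by (rule value_le_tree_value[OF W])
  obtain n where n: "W \<subseteq> short_words n" using short_words_subsetE[OF W(1,2)] .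
  have "short_words n - {[]} = (W - {[]}) \<union> (short_words n - W)" using n W(4) by auto
  then have "tree_value (short_words n) = tree_value W + (\<Sum>w\<in>short_words n - W. edge_gain (hd w))"
    unfolding tree_value_def using W(1) finite_short_words[of n]
    by (simp add: sum.union_disjoint disjoint_iff)
  moreover have "ball_value n \<le> h (eval_word ` W) + (\<Sum>w\<in>short_words n - W. edge_gain (hd w))"
    unfolding ball_value_def
    by (intro tree_growth_le finite_short_words short_words_subset_words tail_closed_short_words W(3,4) n)
  ultimately show "tree_value W \<le> h (eval_word ` W)" using ball[of n] by simp
qed

lemma tree_value_Suc:
  "tree_value (short_words (Suc n)) = tree_value (short_words n) + (\<Sum>b\<in>signs. signed_layer_gain b (Suc n))"
proof -
  have fs: "finite signs" by (rule finite_subset[OF subset_UNIV]) simp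
  have "short_words (Suc n) - {[]} = (short_words n - {[]}) \<union> layer (Suc n)"
    by (auto simp: short_words_Suc layer_def)
  then have "tree_value (short_words (Suc n)) =
      tree_value (short_words n) + (\<Sum>w\<in>layer (Suc n). edge_gain (hd w))"
    unfolding tree_value_def using finite_short_words finite_layer short_words_layer_disjoint[of n]
    by (simp add: sum.union_disjoint Diff_Int_distrib2)
  also have "(\<Sum>w\<in>layer (Suc n). edge_gain (hd w)) =
      (\<Sum>w\<in>layer (Suc n). \<Sum>b\<in>signs. if snd (last w) = b then edge_gain (hd w) else 0)"
  proof (intro sum.cong refl)
    fix w assume "w \<in> layer (Suc n)"
    then have "last w \<in> letters" by (cases w rule: rev_cases) (auto simp: layer_def words_def)
    then have "snd (last w) \<in> signs" by (auto simp: letters_def)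
    then show "edge_gain (hd w) = (\<Sum>b\<in>signs. if snd (last w) = b then edge_gain (hd w) else 0)"
      using fs by simp
  qed
  also have "\<dots> = (\<Sum>b\<in>signs. signed_layer_gain b (Suc n))"
    unfolding signed_layer_gain_def by (rule sum.swap)
  finally show ?thesis .
qed

lemma signed_layer_words:
  assumes "b \<in> signs"
  shows "{u \<in> layer (Suc (Suc n)). snd (last u) = b} =
    (\<lambda>(w, i). w @ [(i, b)]) ` (SIGMA w:layer (Suc n). {i \<in> {1..r}. last w \<noteq> (i, \<not> b)})"
    (is "?l = ?r")
proof (intro subset_antisym subsetI)
  fix u assume u: "u \<in> ?l"
  then obtain w a where w: "u = w @ [a]" by (cases u rule: rev_cases) (auto simp: layer_def)
  then have "w \<noteq> []" "snd a = b" using u by (auto simp: layer_def)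
  then have "w \<in> layer (Suc n)" "a \<in> letters" "\<not> cancels (last w) a"
    using u w by (auto simp: layer_def words_def reduced_word_append)
  then have "(w, fst a) \<in> (SIGMA w:layer (Suc n). {i \<in> {1..r}. last w \<noteq> (i, \<not> b)})"
    using \<open>snd a = b\<close> by (auto simp: letters_def)
  moreover have "u = (\<lambda>(w, i). w @ [(i, b)]) (w, fst a)" using w \<open>snd a = b\<close> by (cases a) simp
  ultimately show "u \<in> ?r" by blast
next
  fix u assume "u \<in> ?r"
  then obtain w i where w: "u = w @ [(i, b)]" "w \<in> layer (Suc n)" "i \<in> {1..r}" "last w \<noteq> (i, \<not> b)" by auto
  then have "w \<noteq> []" by (auto simp: layer_def)
  moreover have "(i, b) \<in> letters" using w assms by (simp add: letters_def)
  moreover have "\<not> cancels (last w) (i, b)" using w(4) by (cases "last w") auto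
  ultimately show "u \<in> ?l" using w by (auto simp: layer_def words_def reduced_word_append)
qed

text \<open>
  A nonempty word \<open>w\<close> extends by \<open>(i, b)\<close> on the right for all \<open>i\<close> except the one, if any,
  for which \<open>w\<close> ends in the inverse letter. The extension has the same first letter, hence
  the same gain.
\<close>

lemma signed_layer_gain_Suc:
  assumes b: "b \<in> signs"
  shows "signed_layer_gain b (Suc (Suc n)) =
    real r * (\<Sum>w\<in>layer (Suc n). edge_gain (hd w)) - signed_layer_gain (\<not> b) (Suc n)"
proof -
  have "signed_layer_gain b (Suc (Suc n)) = (\<Sum>u\<in>{u \<in> layer (Suc (Suc n)). snd (last u) = b}. edge_gain (hd u))"
    unfolding signed_layer_gain_def using finite_layer by (simp add: sum.inter_filter)
  also have "\<dots> = (\<Sum>(w, i)\<in>(SIGMA w:layer (Suc n). {i \<in> {1..r}. last w \<noteq> (i, \<not> b)}). edge_gain (hd (w @ [(i, b)])))"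
    unfolding signed_layer_words[OF b]
    by (subst sum.reindex) (auto simp: inj_on_def case_prod_unfold)
  also have "\<dots> = (\<Sum>w\<in>layer (Suc n). \<Sum>i\<in>{i \<in> {1..r}. last w \<noteq> (i, \<not> b)}. edge_gain (hd (w @ [(i, b)])))"
    by (rule sum.Sigma[symmetric]) (auto simp: finite_layer)
  also have "\<dots> = (\<Sum>w\<in>layer (Suc n). real r * edge_gain (hd w) - (if snd (last w) = (\<not> b) then edge_gain (hd w) else 0))"
  proof (intro sum.cong refl)
    fix w assume "w \<in> layer (Suc n)"
    then have w: "w \<noteq> []" "last w \<in> letters" by (cases w rule: rev_cases; auto simp: layer_def words_def)+
    have "{i \<in> {1..r}. last w \<noteq> (i, \<not> b)} = (if snd (last w) = (\<not> b) then {1..r} - {fst (last w)} else {1..r})"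
      by (cases "last w") auto
    moreover have "fst (last w) \<in> {1..r}" using w(2) by (auto simp: letters_def)
    ultimately have "real (card {i \<in> {1..r}. last w \<noteq> (i, \<not> b)}) = real r - (if snd (last w) = (\<not> b) then 1 else 0)"
      by (simp add: of_nat_diff)
    moreover have "(\<Sum>i\<in>{i \<in> {1..r}. last w \<noteq> (i, \<not> b)}. edge_gain (hd (w @ [(i, b)]))) =
        real (card {i \<in> {1..r}. last w \<noteq> (i, \<not> b)}) * edge_gain (hd w)"
      by (simp only: hd_append2[OF w(1)] sum_constant)
    ultimately show "(\<Sum>i\<in>{i \<in> {1..r}. last w \<noteq> (i, \<not> b)}. edge_gain (hd (w @ [(i, b)]))) =
        real r * edge_gain (hd w) - (if snd (last w) = (\<not> b) then edge_gain (hd w) else 0)"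
      by (simp add: left_diff_distrib)
  qed
  also have "\<dots> = real r * (\<Sum>w\<in>layer (Suc n). edge_gain (hd w)) - signed_layer_gain (\<not> b) (Suc n)"
    by (simp add: sum_subtractf sum_distrib_left signed_layer_gain_def)
  finally show ?thesis .
qed

lemma ball_value_0: "ball_value 0 = h {\<one>\<^bsub>G\<^esub>}"
  by (simp add: ball_value_def short_words_0 eval_word_simps)

lemma tree_value_0: "tree_value (short_words 0) = h {\<one>\<^bsub>G\<^esub>}"
  by (simp add: tree_value_def short_words_0)

lemma F_on_ball_0: "F_on_ball 0 = (1 - real r) * h {\<one>\<^bsub>G\<^esub>} + (\<Sum>i = 1..r. edge_gain (i, True))"
proof -
  have "(\<Sum>i = 1..r. h (eval_word ` short_words 0 \<union> (\<lambda>x. x \<otimes>\<^bsub>G\<^esub> s i) ` eval_word ` short_words 0)) =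
      (\<Sum>i = 1..r. h {\<one>\<^bsub>G\<^esub>} + edge_gain (i, True))"
    using generator_closed
    by (intro sum.cong refl) (simp add: short_words_0 eval_word_simps edge_gain_def insert_commute)
  then show ?thesis
    by (simp add: F_on_ball_def ball_value_0 sum.distrib algebra_simps)
qed

lemma signed_layer_gain_1:
  assumes "b \<in> signs"
  shows "signed_layer_gain b (Suc 0) = (\<Sum>i = 1..r. edge_gain (i, True))"
proof -
  have "{u \<in> layer (Suc 0). snd (last u) = b} = (\<lambda>i. [(i, b)]) ` {1..r}"
    using assms by (auto simp: layer_def words_def letters_def length_Suc_conv)
  moreover have "signed_layer_gain b (Suc 0) = (\<Sum>u\<in>{u \<in> layer (Suc 0). snd (last u) = b}. edge_gain (hd u))"
    unfolding signed_layer_gain_def using finite_layer by (simp add: sum.inter_filter)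
  ultimately have "signed_layer_gain b (Suc 0) = (\<Sum>i = 1..r. edge_gain (i, b))"
    by (simp add: sum.reindex inj_on_def)
  then show ?thesis by (simp add: edge_gain_def)
qed

text \<open>
  By \<open>signed_layer_gain_Suc\<close>, \<open>\<sigma>\<^sub>b(n+2) = (r - 1) \<sigma>(n+1) + \<sigma>\<^sub>b(n+1)\<close>, where \<open>\<sigma>\<^sub>b\<close> is the
  gain of sign \<open>b\<close> and \<open>\<sigma>\<close> the total gain of a layer; and \<open>\<sigma>(n+1)\<close> is the increment of the
  tree value.
\<close>

lemma signed_layer_gain_eq:
  assumes b: "b \<in> signs"
  shows "signed_layer_gain b (Suc n) = F_on_ball 0 + (real r - 1) * tree_value (short_words n)"
proof (induction n)
  case 0
  then show ?case by (simp add: signed_layer_gain_1[OF b] F_on_ball_0 tree_value_0 algebra_simps)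
next
  case (Suc n)
  have layer_total: "(\<Sum>w\<in>layer (Suc n). edge_gain (hd w)) = signed_layer_gain b (Suc n) + signed_layer_gain (\<not> b) (Suc n)"
    unfolding signed_layer_gain_def sum.distrib[symmetric] by (intro sum.cong) auto
  have "(\<Sum>w\<in>layer (Suc n). edge_gain (hd w)) = (\<Sum>b\<in>signs. signed_layer_gain b (Suc n))"
  proof (cases "signs = UNIV")
    case True
    then have "(\<Sum>b\<in>signs. f b) = f True + f False" for f :: "bool \<Rightarrow> real"
      by (simp add: UNIV_bool)
    then show ?thesis by (cases b) (simp_all add: layer_total)
  next
    case False
    then have sg: "signs = {True}" using signs_cases by auto
    have sum_signs: "(\<Sum>b\<in>signs. f b) = f True" for f :: "bool \<Rightarrow> real" by (subst sg) simp
    have b_True: "b = True" using b sg by blast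
    have "signed_layer_gain False (Suc n) = 0"
      unfolding signed_layer_gain_def
    proof (intro sum.neutral ballI)
      fix w assume "w \<in> layer (Suc n)"
      then have "last w \<in> letters" by (cases w rule: rev_cases) (auto simp: layer_def words_def)
      then have "snd (last w) \<in> signs" by (auto simp: letters_def)
      then have "snd (last w) = True" using sg by blast
      then show "(if snd (last w) = False then edge_gain (hd w) else 0) = 0" by simp
    qed
    then show ?thesis unfolding sum_signs layer_total b_True by simp
  qed
  then have total: "(\<Sum>w\<in>layer (Suc n). edge_gain (hd w)) = tree_value (short_words (Suc n)) - tree_value (short_words n)"
    by (simp add: tree_value_Suc)
  have "signed_layer_gain b (Suc (Suc n)) =
      (real r - 1) * (\<Sum>w\<in>layer (Suc n). edge_gain (hd w)) + signed_layer_gain b (Suc n)"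
    using signed_layer_gain_Suc[OF b, of n] layer_total by (simp add: left_diff_distrib)
  then show ?case unfolding total using Suc by (simp add: algebra_simps)
qed

lemma tree_value_recursion:
  "tree_value (short_words (Suc n)) =
    tree_value (short_words n) + real (card signs) * (F_on_ball 0 + (real r - 1) * tree_value (short_words n))"
  using signed_layer_gain_eq by (simp add: tree_value_Suc)

text \<open>
  The number \<open>card signs\<close> is 2 for a group and 1 for a semigroup. In the group case the ball
  of radius \<open>n\<close> lies in the translate by \<open>s\<^sub>i\<close> of the ball of radius \<open>n + 1\<close>, since it can
  be moved back by the inverse of \<open>s\<^sub>i\<close>; this is where the extra term \<open>F_on_ball n\<close> comes
  from.
\<close>

lemma F_on_ball_submodular:
  "F_on_ball (Suc n) + (real (card signs) - 1) * F_on_ball n + (1 + real (card signs) * (real r - 1)) * ball_value n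
    \<le> ball_value (Suc n)"
proof -
  let ?B = "\<lambda>n. eval_word ` short_words n" and ?T = "\<lambda>i W. (\<lambda>x. x \<otimes>\<^bsub>G\<^esub> s i) ` W"
  have B: "finite (?B n)" "?B n \<subseteq> carrier G" for n
    using finite_short_words eval_image_closed[OF short_words_subset_words] by auto
  have T: "finite (?T i (?B n))" "?T i (?B n) \<subseteq> carrier G" "h (?T i (?B n)) = ball_value n"
    if "i \<in> {1..r}" for i n
    using that B[of n] generator_closed[OF that] translation[OF B[of n] generator_closed[OF that]]
    by (auto simp: ball_value_def)
  have mono: "?B n \<subseteq> ?B (Suc n)" by (auto simp: short_words_Suc)
  have right: "?T i (?B n) \<subseteq> ?B (Suc n)" if "i \<in> {1..r}" for i
    using right_multiply_short_words[of "(i, True)"] that True_in_signs by (auto simp: letters_def)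
  have sub: "h (?B (Suc n) \<union> ?T i (?B (Suc n))) + h C \<le> 2 * ball_value (Suc n)"
    if "i \<in> {1..r}" "C \<subseteq> ?B (Suc n) \<inter> ?T i (?B (Suc n))" for i C
    using submodular[OF B(1) T(1) B(2) T(2), OF that(1) that(1), of C "Suc n" "Suc n"] that T(3)[OF that(1), of "Suc n"]
    by (simp add: ball_value_def)
  have sum_sub: "F_on_ball (Suc n) + (\<Sum>i = 1..r. h (C i)) \<le> ball_value (Suc n)"
    if "\<And>i. i \<in> {1..r} \<Longrightarrow> C i \<subseteq> ?B (Suc n) \<inter> ?T i (?B (Suc n))" for C
  proof -
    have "(\<Sum>i = 1..r. h (?B (Suc n) \<union> ?T i (?B (Suc n)))) + (\<Sum>i = 1..r. h (C i)) \<le>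
        (\<Sum>i = 1..r. 2 * ball_value (Suc n))"
      unfolding sum.distrib[symmetric] using sub that by (intro sum_mono) auto
    then show ?thesis by (simp add: F_on_ball_def algebra_simps)
  qed
  show ?thesis
  proof (cases "signs = {True}")
    case True
    have "F_on_ball (Suc n) + (\<Sum>i = 1..r. h (?T i (?B n))) \<le> ball_value (Suc n)"
      using right mono by (intro sum_sub) auto
    moreover have "(\<Sum>i = 1..r. h (?T i (?B n))) = real r * ball_value n" using T(3) by simp
    moreover have "card signs = 1" by (subst True) simp
    ultimately show ?thesis by simp
  next
    case False
    then have sg: "signs = UNIV" and "group G" using signs_cases by auto
    then interpret group G by simp
    have F: "False \<in> signs" by (subst sg) simp
    have "?B n \<subseteq> ?T i (?B (Suc n))" if i: "i \<in> {1..r}" for i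
    proof
      fix x assume x: "x \<in> ?B n"
      then have xc: "x \<in> carrier G" using B(2) by auto
      have "x \<otimes>\<^bsub>G\<^esub> inv\<^bsub>G\<^esub> (s i) \<in> ?B (Suc n)"
        using right_multiply_short_words[of "(i, False)"] x i F by (auto simp: letters_def)
      moreover have "x = (x \<otimes>\<^bsub>G\<^esub> inv\<^bsub>G\<^esub> (s i)) \<otimes>\<^bsub>G\<^esub> s i"
        using xc generator_closed[OF i] by (simp add: G.m_assoc)
      ultimately show "x \<in> ?T i (?B (Suc n))" by blast
    qed
    then have "F_on_ball (Suc n) + (\<Sum>i = 1..r. h (?B n \<union> ?T i (?B n))) \<le> ball_value (Suc n)"
      using right mono by (intro sum_sub) auto
    moreover have "card signs = 2" by (subst sg) simp
    ultimately show ?thesis by (simp add: F_on_ball_def algebra_simps)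
  qed
qed

lemma F_on_ball_1_le: "F_on_ball 1 \<le> F_on_ball 0"
proof -
  have "F_on_ball (Suc 0) + (real (card signs) - 1) * F_on_ball 0 +
      (1 + real (card signs) * (real r - 1)) * h {\<one>\<^bsub>G\<^esub>} \<le> tree_value (short_words (Suc 0))"
    using F_on_ball_submodular[of 0] ball_value_le[of "Suc 0"] by (simp add: ball_value_0)
  then show ?thesis
    by (simp add: tree_value_recursion tree_value_0 algebra_simps)
qed

text \<open>
  Here \<open>F_on_ball_submodular\<close> gives the ball values at least the growth that
  \<open>tree_value_recursion\<close> prescribes for the tree values, which bound them from above.
\<close>

lemma ball_value_exact:
  assumes ge: "\<And>n. n > 0 \<Longrightarrow> F_on_ball 0 \<le> F_on_ball n"
  shows "ball_value n = tree_value (short_words n)"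
proof (induction n)
  case 0
  then show ?case by (simp add: ball_value_0 tree_value_0)
next
  case (Suc n)
  have "F_on_ball 0 \<le> F_on_ball n" "F_on_ball 0 \<le> F_on_ball (Suc n)" using ge by (cases n; simp)+
  moreover have c: "real (card signs) - 1 \<ge> 0" using signs_cases by (auto simp: UNIV_bool)
  ultimately have "F_on_ball 0 + (real (card signs) - 1) * F_on_ball 0 \<le> F_on_ball (Suc n) + (real (card signs) - 1) * F_on_ball n"
    by (intro add_mono mult_left_mono) auto
  then have "real (card signs) * F_on_ball 0 + (1 + real (card signs) * (real r - 1)) * ball_value n \<le> ball_value (Suc n)"
    using F_on_ball_submodular[of n] by (simp add: algebra_simps)
  then have "tree_value (short_words (Suc n)) \<le> ball_value (Suc n)"
    unfolding Suc.IH by (simp add: tree_value_recursion algebra_simps)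
  then show ?case using ball_value_le[of "Suc n"] by simp
qed

lemma tail_closed_avoiding:
  assumes "tail_closed V"
  shows "tail_closed {v \<in> V. \<not> suffix u v}"
  unfolding tail_closed_def
proof
  fix v assume v: "v \<in> {v \<in> V. \<not> suffix u v}"
  then have "\<not> suffix u (tl v)" using suffix_order.trans[OF _ suffix_tl] by blast
  then show "tl v \<in> {v \<in> V. \<not> suffix u v}" using v assms by (auto simp: tail_closed_def)
qed

text \<open>
  The largest subset of a ball avoiding the branch above \<open>t # w\<close> is a subtree \<open>U\<close>, and so is
  \<open>U\<close> with \<open>t # w\<close> added; both attain their tree values, so the gain over \<open>U\<close> is maximal. By
  submodularity the gain over the smaller set \<open>V\<close> is at least as large.
\<close>

lemma leaf_gain_exact:
  assumes ball: "\<And>n. ball_value n = tree_value (short_words n)"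
    and tw: "t # w \<in> words"
    and V: "finite V" "V \<subseteq> words" "w \<in> V" "\<And>v. v \<in> V \<Longrightarrow> \<not> suffix (t # w) v"
  shows "h (insert (eval_word (t # w)) (eval_word ` V)) = h (eval_word ` V) + edge_gain t"
proof (rule antisym)
  have t: "t \<in> letters" "w \<in> words" using tw words_Cons by auto
  show "h (insert (eval_word (t # w)) (eval_word ` V)) \<le> h (eval_word ` V) + edge_gain t"
    unfolding eval_word_simps using V t eval_image_closed[OF V(2)] by (intro leaf_gain_le) auto
  obtain n where n: "insert (t # w) V \<subseteq> short_words n"
    using short_words_subsetE[of "insert (t # w) V"] V tw by auto
  \<comment> \<open>The ball without the branch above \<open>t # w\<close>.\<close>
  define U where "U = {v \<in> short_words n. \<not> suffix (t # w) v}"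
  have U: "finite U" "U \<subseteq> words" "tail_closed U" "[] \<in> U" "V \<subseteq> U" "t # w \<notin> U"
    using finite_short_words[of n] short_words_subset_words n V(4)
      tail_closed_avoiding[OF tail_closed_short_words]
    by (auto simp: U_def)
  have tU: "tail_closed (insert (t # w) U)"
    using U(3,5) V(3) by (auto simp: tail_closed_def)
  have hU: "h (eval_word ` U) = tree_value U"
    by (rule tree_value_exact[OF ball U(1-4)])
  have "h (eval_word ` insert (t # w) U) = tree_value (insert (t # w) U)"
    using U tw by (intro tree_value_exact[OF ball] tU) auto
  also have "\<dots> = tree_value U + edge_gain t"
    unfolding tree_value_def using U(1,6) by (simp add: insert_Diff_if)
  finally have htU: "h (eval_word ` insert (t # w) U) = tree_value U + edge_gain t" .
  have "insert (eval_word (t # w)) (eval_word ` V) \<union> eval_word ` U = eval_word ` insert (t # w) U"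
    using U(5) by auto
  moreover have "h (insert (eval_word (t # w)) (eval_word ` V) \<union> eval_word ` U) + h (eval_word ` V) \<le>
      h (insert (eval_word (t # w)) (eval_word ` V)) + h (eval_word ` U)"
    using U V eval_image_closed[OF V(2)] eval_image_closed[OF U(2)] words_closed[OF tw]
    by (intro submodular) auto
  ultimately show "h (eval_word ` V) + edge_gain t \<le> h (insert (eval_word (t # w)) (eval_word ` V))"
    using htU hU by simp
qed

text \<open>
  In a semigroup, \<open>tg\<close> is always a child of \<open>g\<close> and the past avoids the branch above \<open>tg\<close>.
  In a group, \<open>tg\<close> may be the parent of \<open>g\<close>, but translation by the inverse of \<open>g\<close> reduces
  to \<open>g = e\<close>.
\<close>

lemma markov_function_if_ball_exact:
  assumes ball: "\<And>n. ball_value n = tree_value (short_words n)"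
  shows "markov_function"
  unfolding markov_function_def
proof clarify
  fix t g V
  assume t: "t \<in> letters" and g: "g \<in> carrier G" and V: "finite V" "g \<in> V"
    and past: "V \<subseteq> Past G (letter ` letters) (letter t \<otimes>\<^bsub>G\<^esub> g) g"
  have VG: "V \<subseteq> carrier G" using past by (auto simp: Past_def)
  have "h (insert (letter t \<otimes>\<^bsub>G\<^esub> g) V) = h V + edge_gain t"
  proof (cases "signs = {True}")
    case True
    \<comment> \<open>Substituting by hand, as the simplifier would also rewrite the locale parameter inside \<open>letters\<close>.\<close>
    have letters_eq: "letters = {1..r} \<times> {True}"
      by (subst letters_def, subst True, rule refl)
    have reduced: "u \<in> words" if "set u \<subseteq> letters" for u
      using that positive_word_reduced[of u "{1..r}"] unfolding words_def letters_eq by simp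
    obtain w where w: "w \<in> words" "g = eval_word w" using obtain_word[OF g] .
    have tw: "t # w \<in> words" using w t by (intro reduced) (simp add: words_def)
    define U where "U = {v \<in> words. eval_word v \<in> V}"
    have VU: "V = eval_word ` U" using VG unfolding U_def by (auto elim!: obtain_word)
    have inj: "inj_on eval_word U" by (rule inj_on_subset[OF eval_words_inj]) (auto simp: U_def)
    have "finite (eval_word ` U)" using V(1) unfolding VU .
    then have U: "finite U" "U \<subseteq> words" "w \<in> U"
      using inj V(2) w by (auto simp: U_def finite_image_iff)
    have "\<not> suffix (t # w) v" if v: "v \<in> U" for v
    proof
      assume "suffix (t # w) v"
      then obtain v' where v': "v = v' @ [t] @ w" by (auto simp: suffix_def)
      have "v \<in> words" using v U(2) by blast
      then have vw: "set (v' @ [t]) \<subseteq> letters" unfolding words_def v' by simp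
      have "eval_word v = eval_word (v' @ [t]) \<otimes>\<^bsub>G\<^esub> g"
        using eval_word_append[OF vw, of w] w v' by (simp add: words_def)
      then show False
        using not_in_Past[OF reduced[OF vw] g] v past by (auto simp: U_def)
    qed
    from leaf_gain_exact[OF ball tw U this] show ?thesis
      by (simp add: VU w(2) eval_word_simps)
  next
    case False
    then have "group G" using signs_cases by auto
    then interpret group G .
    let ?g' = "inv\<^bsub>G\<^esub> g"
    \<comment> \<open>The words of \<open>V\<close> translated by the inverse of \<open>g\<close>.\<close>
    define U where "U = {v \<in> words. eval_word v \<otimes>\<^bsub>G\<^esub> g \<in> V}"
    have VU: "(\<lambda>x. x \<otimes>\<^bsub>G\<^esub> ?g') ` V = eval_word ` U"
    proof (intro subset_antisym subsetI)
      fix x assume "x \<in> (\<lambda>x. x \<otimes>\<^bsub>G\<^esub> ?g') ` V"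
      then obtain y where y: "y \<in> V" "x = y \<otimes>\<^bsub>G\<^esub> ?g'" by auto
      then have "x \<in> carrier G" "x \<otimes>\<^bsub>G\<^esub> g = y" using VG g by (auto simp: G.m_assoc)
      then show "x \<in> eval_word ` U" using y(1) obtain_word[of x] unfolding U_def by blast
    next
      fix x assume "x \<in> eval_word ` U"
      then obtain v where v: "v \<in> words" "eval_word v \<otimes>\<^bsub>G\<^esub> g \<in> V" "x = eval_word v" by (auto simp: U_def)
      then have "x = (eval_word v \<otimes>\<^bsub>G\<^esub> g) \<otimes>\<^bsub>G\<^esub> ?g'" using g words_closed by (simp add: G.m_assoc)
      then show "x \<in> (\<lambda>x. x \<otimes>\<^bsub>G\<^esub> ?g') ` V" using v(2) by blast
    qed
    have tw: "[t] \<in> words" using t by (simp add: words_def)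
    have inj: "inj_on eval_word U" by (rule inj_on_subset[OF eval_words_inj]) (auto simp: U_def)
    have "finite (eval_word ` U)" unfolding VU[symmetric] using V(1) by simp
    then have U: "finite U" "U \<subseteq> words" "[] \<in> U"
      using inj V(2) g by (auto simp: U_def eval_word_simps finite_image_iff)
    have "\<not> suffix [t] v" if v: "v \<in> U" for v
    proof
      assume "suffix [t] v"
      then obtain v' where v': "v = v' @ [t]" by (auto simp: suffix_def)
      then show False
        using not_in_Past[OF _ g, of v' t] v past by (auto simp: U_def)
    qed
    from leaf_gain_exact[OF ball tw U this]
    have "h (insert (letter t) (eval_word ` U)) = h (eval_word ` U) + edge_gain t"
      using letter_closed[OF t] by (simp add: eval_word_simps)
    moreover have "h (eval_word ` U) = h V"
      unfolding VU[symmetric] using V VG g by (intro translation) auto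
    moreover have "h (insert (letter t) (eval_word ` U)) = h (insert (letter t \<otimes>\<^bsub>G\<^esub> g) V)"
    proof -
      have eq: "insert (letter t) (eval_word ` U) = (\<lambda>x. x \<otimes>\<^bsub>G\<^esub> ?g') ` insert (letter t \<otimes>\<^bsub>G\<^esub> g) V"
        using VU letter_closed[OF t] g by (simp add: G.m_assoc)
      show ?thesis unfolding eq using V VG g letter_closed[OF t] by (intro translation) auto
    qed
    ultimately show ?thesis by simp
  qed
  then show "h (insert (letter t \<otimes>\<^bsub>G\<^esub> g) V) + h {g} = h V + h {g, letter t \<otimes>\<^bsub>G\<^esub> g}"
    using edge_value[OF t g] singleton_value[OF g] by simp
qed

lemma markov_functionD:
  assumes "markov_function" "t \<in> letters" "g \<in> carrier G" "finite V" "g \<in> V"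
    "V \<subseteq> Past G (letter ` letters) (letter t \<otimes>\<^bsub>G\<^esub> g) g"
  shows "h (insert (letter t \<otimes>\<^bsub>G\<^esub> g) V) + h {g} = h V + h {g, letter t \<otimes>\<^bsub>G\<^esub> g}"
  using assms unfolding markov_function_def by (meson imageI)

text \<open>
  The words of length \<open>n + 1\<close> are added one at a time; each is a leaf attached to the ball,
  and all other words present lie in its past.
\<close>

lemma layer_gain_if_markov_function:
  assumes markov: "markov_function" and U: "finite U" "U \<subseteq> layer (Suc n)"
  shows "h (eval_word ` (short_words n \<union> U)) = ball_value n + (\<Sum>u\<in>U. edge_gain (hd u))"
  using U
proof (induction U rule: finite_induct)
  case empty
  then show ?case by (simp add: ball_value_def)
next
  case (insert u U)
  let ?V = "short_words n \<union> U"
  obtain t w where u: "u = t # w" using insert by (cases u) (auto simp: layer_def)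
  have tw: "t # w \<in> words" "length w = n" using insert u by (auto simp: layer_def)
  have t: "t \<in> letters" "w \<in> words" using words_Cons[OF tw(1)] by auto
  have V: "finite ?V" "?V \<subseteq> words" "w \<in> ?V"
    using finite_short_words insert t tw by (auto simp: short_words_def layer_def)
  have "\<not> suffix (t # w) v" if "v \<in> ?V" for v
  proof
    assume sf: "suffix (t # w) v"
    have "length v \<le> Suc n" using that insert by (auto simp: short_words_def layer_def)
    then have "v = t # w" using sf tw(2) suffix_length_le[OF sf] by (auto simp: suffix_def)
    then show False using that insert u tw(2) by (auto simp: short_words_def)
  qed
  then have "eval_word ` ?V \<subseteq> Past G (letter ` letters) (eval_word (t # w)) (eval_word w)"
    using in_PastI[OF tw(1)] V(2) by blast
  then have "h (insert (letter t \<otimes>\<^bsub>G\<^esub> eval_word w) (eval_word ` ?V)) + h {eval_word w} =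
      h (eval_word ` ?V) + h {eval_word w, letter t \<otimes>\<^bsub>G\<^esub> eval_word w}"
    using V unfolding eval_word_simps
    by (intro markov_functionD[OF markov t(1) words_closed[OF t(2)]]) simp_all
  then have "h (insert (eval_word u) (eval_word ` ?V)) = h (eval_word ` ?V) + edge_gain t"
    using edge_value[OF t(1) words_closed[OF t(2)]] singleton_value[OF words_closed[OF t(2)]]
    by (simp add: u eval_word_simps)
  then show ?case using insert u by simp
qed

text \<open>
  All entropies in \<open>F_on_ball n\<close> are now tree values, so that it equals \<open>(1 - r) T + \<sigma>\<close> with
  \<open>T\<close> the tree value of the ball and \<open>\<sigma>\<close> the gain of the words of length \<open>n + 1\<close> with
  positive last letter; \<open>signed_layer_gain_eq\<close> evaluates \<open>\<sigma>\<close>.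
\<close>

lemma F_on_ball_if_markov_function:
  assumes markov: "markov_function"
  shows "F_on_ball n = F_on_ball 0"
proof -
  have ball: "ball_value n = tree_value (short_words n)" for n
  proof (induction n)
    case 0
    then show ?case by (simp add: ball_value_0 tree_value_0)
  next
    case (Suc n)
    have "short_words (Suc n) - {[]} = (short_words n - {[]}) \<union> layer (Suc n)"
      by (auto simp: short_words_Suc layer_def)
    then have "tree_value (short_words (Suc n)) =
        tree_value (short_words n) + (\<Sum>w\<in>layer (Suc n). edge_gain (hd w))"
      unfolding tree_value_def using finite_short_words finite_layer short_words_layer_disjoint[of n]
      by (simp add: sum.union_disjoint Diff_Int_distrib2)
    then show ?case
      using layer_gain_if_markov_function[OF markov finite_layer subset_refl, of n] Suc
      by (simp add: ball_value_def short_words_Suc)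
  qed
  have "(\<Sum>i = 1..r. h (eval_word ` short_words n \<union> (\<lambda>x. x \<otimes>\<^bsub>G\<^esub> s i) ` eval_word ` short_words n)) =
      (\<Sum>i = 1..r. ball_value n + (\<Sum>u\<in>layer (Suc n). if last u = (i, True) then edge_gain (hd u) else 0))"
  proof (intro sum.cong refl)
    fix i assume i: "i \<in> {1..r}"
    show "h (eval_word ` short_words n \<union> (\<lambda>x. x \<otimes>\<^bsub>G\<^esub> s i) ` eval_word ` short_words n) =
      ball_value n + (\<Sum>u\<in>layer (Suc n). if last u = (i, True) then edge_gain (hd u) else 0)"
      unfolding ball_Un_right_translate[OF i]
      using layer_gain_if_markov_function[OF markov, of "{u \<in> layer (Suc n). last u = (i, True)}" n] finite_layer
      by (simp add: sum.inter_filter)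
  qed
  also have "\<dots> = real r * ball_value n +
      (\<Sum>u\<in>layer (Suc n). \<Sum>i = 1..r. if last u = (i, True) then edge_gain (hd u) else 0)"
    by (simp add: sum.distrib) (rule sum.swap)
  also have "(\<Sum>u\<in>layer (Suc n). \<Sum>i = 1..r. if last u = (i, True) then edge_gain (hd u) else 0) =
      signed_layer_gain True (Suc n)"
    unfolding signed_layer_gain_def
  proof (intro sum.cong refl)
    fix u assume "u \<in> layer (Suc n)"
    then have "last u \<in> letters" by (cases u rule: rev_cases) (auto simp: layer_def words_def)
    then have "fst (last u) \<in> {1..r}" by (auto simp: letters_def)
    then show "(\<Sum>i = 1..r. if last u = (i, True) then edge_gain (hd u) else 0) =
        (if snd (last u) = True then edge_gain (hd u) else 0)"
      by (cases "last u") (auto intro: sum.neutral)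
  qed
  finally show ?thesis
    using signed_layer_gain_eq[OF True_in_signs, of n] by (simp add: F_on_ball_def ball algebra_simps)
qed

lemma markov_function_iff: "markov_function \<longleftrightarrow> (\<forall>n>0. F_on_ball 0 \<le> F_on_ball n)"
  using F_on_ball_if_markov_function ball_value_exact markov_function_if_ball_exact by (metis order_refl)

end

section \<open>Comparison of the two invariants\<close>

lemma free_group_on_free_words:
  assumes "free_group_on G s r"
  shows "free_words G s r UNIV"
  using assms unfolding free_group_on_def free_words_def by (auto intro: group.is_monoid)

lemma free_monoid_on_free_words:
  assumes "free_monoid_on G s r"
  shows "free_words G s r {True}"
proof -
  let ?W = "{w. set w \<subseteq> {1..r} \<times> {True} \<and> reduced_word w}"
  have "bij_betw (map fst) ?W (lists {1..r})"
  proof (rule bij_betwI[where g = "map (\<lambda>i. (i, True))"])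
    show "map fst \<in> ?W \<rightarrow> lists {1..r}" by force
    show "map (\<lambda>i. (i, True)) \<in> lists {1..r} \<rightarrow> ?W"
      using positive_word_reduced[of _ "{1..r}"] by force
    show "map (\<lambda>i. (i, True)) (map fst w) = w" if "w \<in> ?W" for w
      using that by (auto intro!: map_idI)
  qed (simp add: comp_def)
  then have bij: "bij_betw ((\<lambda>w. word_product G (map s w)) \<circ> map fst) ?W (carrier G)"
    using assms unfolding free_monoid_on_def by (intro bij_betw_trans) auto
  have same: "((\<lambda>w. word_product G (map s w)) \<circ> map fst) w = word_product G (map (letter_value G s) w)"
    if "w \<in> ?W" for w
  proof -
    have "map s (map fst w) = map (letter_value G s) w" using that by auto
    then show ?thesis by (simp only: comp_apply)
  qed
  have "bij_betw (\<lambda>w. word_product G (map (letter_value G s) w)) ?W (carrier G)"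
    by (rule iffD1[OF bij_betw_cong[OF same] bij])
  then show ?thesis using assms by (simp add: free_words_def free_monoid_on_def)
qed

context stationary_config
begin

definition site_entropy_real :: "'g set \<Rightarrow> real" where
  "site_entropy_real W = enn2real (site_entropy W)"

lemma site_entropy_real:
  assumes "finite W" "W \<subseteq> carrier G"
  shows "site_entropy W = ennreal (site_entropy_real W)" "site_entropy_real W \<ge> 0"
  using site_entropy_finite[OF assms] by (simp_all add: site_entropy_real_def)

lemma site_entropy_real_add_iff:
  assumes "finite A" "A \<subseteq> carrier G" "finite B" "B \<subseteq> carrier G"
    "finite C" "C \<subseteq> carrier G" "finite D" "D \<subseteq> carrier G"
  shows "site_entropy A + site_entropy B \<le> site_entropy C + site_entropy D \<longleftrightarrow>
      site_entropy_real A + site_entropy_real B \<le> site_entropy_real C + site_entropy_real D"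
    and "site_entropy A + site_entropy B = site_entropy C + site_entropy D \<longleftrightarrow>
      site_entropy_real A + site_entropy_real B = site_entropy_real C + site_entropy_real D"
  using assms by (simp_all add: site_entropy_real ennreal_plus[symmetric] del: ennreal_plus)

lemma stationary_set_function_site_entropy:
  assumes "free_words G s r signs"
  shows "stationary_set_function G s r signs site_entropy_real"
proof -
  interpret free_words G s r signs by (rule assms)
  show ?thesis
  proof
    fix A B C :: "'g set"
    assume AB: "finite A" "finite B" "A \<subseteq> carrier G" "B \<subseteq> carrier G" "C \<subseteq> A \<inter> B"
    then have "finite C" "C \<subseteq> carrier G" using finite_subset by auto
    then show "site_entropy_real (A \<union> B) + site_entropy_real C \<le> site_entropy_real A + site_entropy_real B"
      using site_entropy_submodular[OF AB] AB by (subst (asm) site_entropy_real_add_iff) auto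
  next
    fix W g assume "finite W" "W \<subseteq> carrier G" "g \<in> carrier G"
    then show "site_entropy_real ((\<lambda>w. w \<otimes>\<^bsub>G\<^esub> g) ` W) = site_entropy_real W"
      by (simp add: site_entropy_real_def site_entropy_translate)
  qed
qed

lemma F_inv_eq:
  assumes W: "finite W" "W \<subseteq> carrier G" "observed_partition G K W P" and s: "s ` {1..r} \<subseteq> carrier G"
  shows "F_inv G K s r \<mu> P = (1 - 2 * real r) * site_entropy_real W +
    (\<Sum>i = 1..r. site_entropy_real (W \<union> (\<lambda>x. x \<otimes>\<^bsub>G\<^esub> s i) ` W))"
proof -
  have "enn2real (partition_entropy \<mu> (partition_join P (pullback_partition G K (s i) P))) =
      site_entropy_real (W \<union> (\<lambda>x. x \<otimes>\<^bsub>G\<^esub> s i) ` W)" if "i \<in> {1..r}" for i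
  proof -
    have i: "s i \<in> carrier G" using s that by auto
    have obs: "observed_partition G K (W \<union> (\<lambda>x. x \<otimes>\<^bsub>G\<^esub> s i) ` W) (partition_join P (pullback_partition G K (s i) P))"
      by (intro observed_partition_join observed_partition_pullback W monoid_G i)
    have "W \<union> (\<lambda>x. x \<otimes>\<^bsub>G\<^esub> s i) ` W \<subseteq> carrier G"
      using W(2) i monoid.m_closed[OF monoid_G] by auto
    from observed_partition_entropy[OF _ this obs] show ?thesis
      using W(1) by (simp add: site_entropy_real_def)
  qed
  then show ?thesis
    unfolding F_inv_def by (simp add: observed_partition_entropy[OF W] site_entropy_real_def)
qed

lemma observed_partition_ball:
  assumes "word_ball G S n \<noteq> {}"
  shows "observed_partition G K (word_ball G S n) (ball_partition G K S n (canonical_partition G K))"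
proof -
  have "observed_partition G K {g} (pullback_partition G K g (canonical_partition G K))"
    if "g \<in> word_ball G S n" for g
  proof -
    have g: "g \<in> carrier G" using that by (simp add: word_ball_def)
    show ?thesis
      using observed_partition_pullback[OF monoid_G g _ observed_partition_canonical[OF monoid_G, of K]]
        monoid.one_closed[OF monoid_G] monoid.l_one[OF monoid_G g] by simp
  qed
  then have "observed_partition G K (\<Union>g\<in>word_ball G S n. {g}) (ball_partition G K S n (canonical_partition G K))"
    unfolding ball_partition_def by (rule observed_partition_Join[OF _ assms])
  then show ?thesis by simp
qed

end

theorem corollary11p2:
  fixes G :: "('g, 'm) monoid_scheme" and s :: "nat \<Rightarrow> 'g" and r :: nat and S :: "'g set"
    and K :: "'k set" and \<mu> :: "('g \<Rightarrow> 'k) measure"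
  assumes free: "(free_group_on G s r \<and> S = s ` {1..r} \<union> (\<lambda>i. inv\<^bsub>G\<^esub> (s i)) ` {1..r}) \<or>
                 (free_monoid_on G s r \<and> S = s ` {1..r})"
    and "countable K"
    and "prob_space \<mu>"
    and "sets \<mu> = sets (borel_of_topology (config_topology G K))"
    and "action_invariant G K \<mu>"
    and "partition_entropy \<mu> (canonical_partition G K) < \<infinity>"
  shows "f_inv G K s r S \<mu> (canonical_partition G K)
           \<le> ereal (F_inv G K s r \<mu> (canonical_partition G K)) \<and>
         (f_inv G K s r S \<mu> (canonical_partition G K)
           = ereal (F_inv G K s r \<mu> (canonical_partition G K)) \<longleftrightarrow>
          Markov G K S \<mu> (canonical_partition G K))"
proof -
  obtain signs where words: "free_words G s r signs" and S: "S = letter_value G s ` ({1..r} \<times> signs)"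
  proof -
    have group_S: "s ` {1..r} \<union> (\<lambda>i. inv\<^bsub>G\<^esub> (s i)) ` {1..r} = letter_value G s ` ({1..r} \<times> UNIV)"
      by (force simp: UNIV_bool)
    have monoid_S: "s ` {1..r} = letter_value G s ` ({1..r} \<times> {True})" by force
    from free show ?thesis
      using that[of UNIV] that[of "{True}"] free_group_on_free_words free_monoid_on_free_words
        group_S monoid_S by metis
  qed
  interpret free_words G s r signs by (rule words)
  interpret stationary_config G K \<mu>
    using assms monoid_G by (simp add: stationary_config_def stationary_config_axioms_def)
  interpret stationary_set_function G s r signs site_entropy_real
    by (rule stationary_set_function_site_entropy[OF words])
  have S': "S = letter ` letters" by (simp add: S letters_def)
  let ?\<alpha> = "canonical_partition G K"
  have F_ball: "F_inv G K s r \<mu> (ball_partition G K S n ?\<alpha>) = F_on_ball n" for n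
  proof -
    have "word_ball G S n \<noteq> {}" unfolding S' word_ball_eq using Nil_short_words by blast
    note observed_partition_ball[OF this]
    then show ?thesis
      unfolding S' word_ball_eq F_on_ball_def ball_value_def using generators
      by (intro F_inv_eq finite_imageI finite_short_words eval_image_closed short_words_subset_words)
  qed
  have F_0: "F_inv G K s r \<mu> ?\<alpha> = F_on_ball 0"
    unfolding F_on_ball_def ball_value_def
    using observed_partition_canonical[OF monoid_G, of K] generators monoid.one_closed[OF monoid_G]
    by (subst F_inv_eq[where W = "{\<one>\<^bsub>G\<^esub>}"]) (simp_all add: short_words_0 eval_word_simps)
  have f: "f_inv G K s r S \<mu> ?\<alpha> = (INF n\<in>{0<..}. ereal (F_on_ball n))"
    by (simp add: f_inv_def F_ball)
  have le: "f_inv G K s r S \<mu> ?\<alpha> \<le> ereal (F_on_ball 0)"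
    unfolding f using F_on_ball_1_le by (intro INF_lower2[of 1]) auto
  have "f_inv G K s r S \<mu> ?\<alpha> = ereal (F_on_ball 0) \<longleftrightarrow> (\<forall>n>0. F_on_ball 0 \<le> F_on_ball n)"
  proof -
    have "ereal (F_on_ball 0) \<le> f_inv G K s r S \<mu> ?\<alpha> \<longleftrightarrow> (\<forall>n>0. F_on_ball 0 \<le> F_on_ball n)"
      unfolding f le_INF_iff by auto
    then show ?thesis using le by (metis order_antisym order_refl)
  qed
  also have "\<dots> \<longleftrightarrow> markov_function" by (rule markov_function_iff[symmetric])
  also have "\<dots> \<longleftrightarrow> Markov G K S \<mu> ?\<alpha>"
  proof -
    have SG: "S \<subseteq> carrier G" using letter_closed by (auto simp: S')
    show ?thesis
      unfolding Markov_iff_site_entropy[OF SG] markov_function_def S'[symmetric]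
    proof (intro ball_cong refl all_cong1 imp_cong)
      fix t g V assume tg: "t \<in> S" "g \<in> carrier G"
        and V: "finite V \<and> g \<in> V \<and> V \<subseteq> Past G S (t \<otimes>\<^bsub>G\<^esub> g) g"
      have "t \<otimes>\<^bsub>G\<^esub> g \<in> carrier G" using tg SG monoid.m_closed[OF monoid_G] by auto
      moreover have "V \<subseteq> carrier G" using V Past_subset[of S] by auto
      ultimately show "site_entropy_real (insert (t \<otimes>\<^bsub>G\<^esub> g) V) + site_entropy_real {g} =
          site_entropy_real V + site_entropy_real {g, t \<otimes>\<^bsub>G\<^esub> g} \<longleftrightarrow>
        site_entropy (insert (t \<otimes>\<^bsub>G\<^esub> g) V) + site_entropy {g} =
          site_entropy V + site_entropy {g, t \<otimes>\<^bsub>G\<^esub> g}"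
        using V tg by (subst site_entropy_real_add_iff) auto
    qed
  qed
  finally show ?thesis using le by (simp add: F_0)
qed

end
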